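(* Let $\theta_\ast>0$ and $\sigma>0$ be fixed, and let $c = 8\log(4\theta_\ast/\sigma^2)$. Consider the Poisson mixture model in which $X_1,\dots,X_n$ are i.i.d. with probability mass function $$h_Q^{\rm Pois}(x)=\int_0^{\theta_\ast}\frac{e^{-\theta}\theta^x}{x!}\,\mathrm{d}Q(\theta),\qquad x\in\{0,1,2,\dots\},$$ where $Q$ is an unknown probability measure on $[0,\theta_\ast]$. Let $\hat Q_{\rm MLE}$ be the nonparametric maximum likelihood estimator $$\hat Q_{\rm MLE}\in\operatorname*{argmax}_{\tilde Q\in\mathcal P([0,\theta_\ast])}\sum_{i=1}^n\log h^{\rm Pois}_{\tilde Q}(X_i).$$ Then, as $n\to\infty$, $$\sup_{Q\in\mathcal P([0,\theta_\ast])}\mathbb E\,W_1^\sigma(Q,\hat Q_{\rm MLE})=\begin{cases} O\big(n^{-1/2+c/\log\log n}\,\mathrm{Polylog}(n)\big), & \text{if } \sigma^2<4\theta_\ast,\\ O\big(n^{-1/2}\,\mathrm{Polylog}(n)\big), & \text{if } \sigma^2\ge 4\theta_\ast.\end{cases}$$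
   Context: $\mathcal P([0,\theta_\ast])$ denotes the set of all probability measures on $[0,\theta_\ast]$. $W_1$ denotes the Wasserstein-1 distance between probability measures on $\mathbb R$. For fixed $\sigma>0$, the Gaussian-smoothed optimal transport (GOT) distance is $W_1^\sigma(Q,Q')=W_1\big(Q\ast\mathcal N(0,\sigma^2),\,Q'\ast\mathcal N(0,\sigma^2)\big)$, where $\ast$ denotes convolution of measures. The expectation is over $X_1,\dots,X_n$ i.i.d. from $h_Q^{\rm Pois}$. The $O(\cdot)$ constants may depend on $\theta_\ast$ and $\sigma^2$ but not on $n$ or $Q$, and $\mathrm{Polylog}(n)$ denotes a factor of the form $(\log n)^{a}$ for some constant $a>0$ not depending on $n$. *)

theory Defs
  imports "HOL-Probability.Probability"
begin

definition prob_on :: "real \<Rightarrow> real measure set" where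
  "prob_on tstar = {Q. prob_space Q \<and> sets Q = sets borel \<and> emeasure Q {0..tstar} = 1}"

definition pois_mix :: "real measure \<Rightarrow> nat \<Rightarrow> real" where
  "pois_mix Q x = (\<integral>t. exp (- t) * t ^ x / fact x \<partial>Q)"

definition pois_mix_measure :: "real measure \<Rightarrow> nat measure" where
  "pois_mix_measure Q = density (count_space UNIV) (\<lambda>x. ennreal (pois_mix Q x))"

definition sample_law :: "real measure \<Rightarrow> nat \<Rightarrow> (nat \<Rightarrow> nat) measure" where
  "sample_law Q n = PiM {..<n} (\<lambda>_. pois_mix_measure Q)"

definition couplings :: "real measure \<Rightarrow> real measure \<Rightarrow> (real \<times> real) measure set" where
  "couplings P R = {\<gamma>. prob_space \<gamma> \<and> sets \<gamma> = sets (borel \<Otimes>\<^sub>M borel) \<and>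
      distr \<gamma> borel fst = P \<and> distr \<gamma> borel snd = R}"

definition W1 :: "real measure \<Rightarrow> real measure \<Rightarrow> ennreal" where
  "W1 P R = (INF \<gamma>\<in>couplings P R. \<integral>\<^sup>+ z. ennreal \<bar>fst z - snd z\<bar> \<partial>\<gamma>)"

definition gauss :: "real \<Rightarrow> real measure" where
  "gauss \<sigma> = density lborel (normal_density 0 \<sigma>)"

definition W1_smooth :: "real \<Rightarrow> real measure \<Rightarrow> real measure \<Rightarrow> ennreal" where
  "W1_smooth \<sigma> P R = W1 (P \<star> gauss \<sigma>) (R \<star> gauss \<sigma>)"

text \<open>est is an NPMLE selection for sample size n: for every sample
  (X_0..X_(n-1)) it returns a maximizer over prob_on tstar of the likelihood
  prod_i h(X_i) (equivalently of the log-likelihood sum_i log h(X_i), with log 0 = -infinity).\<close>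
definition is_npmle :: "real \<Rightarrow> nat \<Rightarrow> ((nat \<Rightarrow> nat) \<Rightarrow> real measure) \<Rightarrow> bool" where
  "is_npmle tstar n est \<longleftrightarrow> (\<forall>X. est X \<in> prob_on tstar \<and>
      (\<forall>Q'\<in>prob_on tstar. (\<Prod>i<n. pois_mix Q' (X i)) \<le> (\<Prod>i<n. pois_mix (est X) (X i))))"

end

(*
By the generating function of the Hermite polynomials, the density of Q * N(0, sigma^2) is
  phi_sigma(x) * sum_k He_k(x/sigma + sigma) sigma^(-k) h_Q(k),
so it is a linear image of the mixture pmf h_Q. Two densities p, r are coupled by leaving their
common part in place, at cost at most int |x| |p - r|. By Cauchy-Schwarz and
E He_k(Z + sigma)^2 <= C^2 4^k k!, which follows from Stein's identity,
  W_1^sigma(Q, Q') <= C * sum_k (2/sigma)^k sqrt(k!) |h_Q(k) - h_Q'(k)|.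
Since h_Q(k) <= theta^k / k!, Cauchy-Schwarz bounds the terms with k <= K by the Hellinger
distance times the root of sum_(k <= K) rho^k, where rho = 4 theta / sigma^2. For the estimator the
squared Hellinger distance is controlled by the chi-square statistic of the sample on {0..K},
whose mean is at most (K + 1) / n. Taking K = 16 log n / log log n makes the terms with k > K
negligible, and rho^(K/2) is then n^(c / log log n) when rho > 1.
*)

theory Submission
  imports Defs "HOL-Computational_Algebra.Polynomial_FPS" "HOL-Real_Asymp.Real_Asymp"
begin

text \<open>Over all of the naturals the chi-square statistic has no useful mean, since each cell is
  only bounded by 1/n. Hence the cut at \<open>K\<close>; samples with a point beyond
  \<open>K\<close> are charged to the count \<open>misses\<close>. The Hellinger distance would
  enter as the square root of a random quantity D. It is linearised by 2 sqrt D <= l D + 1/l with l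
  = sqrt n, so that only the mean of the chi-square statistic has to be computed.

  \<open>is_npmle\<close> says nothing about measurability of the estimator. The distance is
  therefore bounded for every single sample by an explicit integrable function, and only that
  function is ever integrated exactly.

  The constants are tied together. The 4 in \<open>\<rho>\<close>, and with it the threshold sigma^2
  = 4 theta, comes from the factor 4^k in the Hermite bound. The 16 in the cut is twice the 8 in
  \<open>c\<close>, because \<open>\<rho>\<close> ^ K appears under a root. At this cut A^K / sqrt
  (K!) is of order n^(-8 + o(1)), which leaves ample room below the n^(-2) that the tail terms
  require.\<close>

section \<open>Wasserstein distance of measures with densities\<close>

text \<open>Both pieces of the coupling live on one product space, and the boolean selects the
  piece. On the diagonal piece the second coordinate is a dummy with density \<open>p\<close>, which
  integrates to 1 and so drops out. The other piece is the independent coupling of the residuals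
  \<open>u\<close> and \<open>v\<close>, normalised by \<open>\<kappa>\<close>.\<close>

lemma nn_integral_common_part_coupling:
  fixes p m u v :: "real \<Rightarrow> ennreal" and \<kappa> :: ennreal and g :: "real \<times> real \<Rightarrow> ennreal"
  defines "M \<equiv> density (count_space (UNIV :: bool set) \<Otimes>\<^sub>M (lborel \<Otimes>\<^sub>M lborel))
      (\<lambda>(b, x, y). if b then m x * p y else u x * v y * \<kappa>)"
  defines "T \<equiv> (\<lambda>(b, x, y). if b then (x, x) else (x, y))"
  assumes [measurable]: "p \<in> borel_measurable borel" "m \<in> borel_measurable borel"
    "u \<in> borel_measurable borel" "v \<in> borel_measurable borel"
    "g \<in> borel_measurable (borel \<Otimes>\<^sub>M borel)"
    and p1: "(\<integral>\<^sup>+y. p y \<partial>lborel) = 1"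
  shows "(\<integral>\<^sup>+z. g z \<partial>distr M (borel \<Otimes>\<^sub>M borel) T)
    = (\<integral>\<^sup>+x. m x * g (x, x) \<partial>lborel) + (\<integral>\<^sup>+x. u x * (\<integral>\<^sup>+y. v y * \<kappa> * g (x, y) \<partial>lborel) \<partial>lborel)"
proof -
  have LL: "sigma_finite_measure (lborel \<Otimes>\<^sub>M lborel :: (real \<times> real) measure)"
    unfolding lborel_prod by (rule lborel.sigma_finite_measure_axioms)
  have T[measurable]: "T \<in> measurable (count_space UNIV \<Otimes>\<^sub>M (lborel \<Otimes>\<^sub>M lborel)) (borel \<Otimes>\<^sub>M borel)"
    unfolding T_def by measurable
  have T'[measurable]: "T \<in> measurable M (borel \<Otimes>\<^sub>M borel)"
    unfolding M_def by measurable
  have "(\<integral>\<^sup>+z. g z \<partial>distr M (borel \<Otimes>\<^sub>M borel) T) = (\<integral>\<^sup>+w. g (T w) \<partial>M)"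
    by (rule nn_integral_distr) measurable
  also have "\<dots> = (\<integral>\<^sup>+w. (case w of (b, x, y) \<Rightarrow> if b then m x * p y else u x * v y * \<kappa>) * g (T w)
      \<partial>(count_space UNIV \<Otimes>\<^sub>M (lborel \<Otimes>\<^sub>M lborel)))"
    unfolding M_def by (rule nn_integral_density) measurable
  also have "\<dots> = (\<integral>\<^sup>+b. \<integral>\<^sup>+z. (case z of (x, y) \<Rightarrow> if b then m x * p y else u x * v y * \<kappa>) * g (T (b, z))
      \<partial>(lborel \<Otimes>\<^sub>M lborel) \<partial>count_space UNIV)"
    by (subst sigma_finite_measure.nn_integral_fst[OF LL, symmetric]) (auto simp: case_prod_beta)
  also have "\<dots> = (\<integral>\<^sup>+z. (case z of (x, y) \<Rightarrow> m x * p y * g (x, x)) \<partial>(lborel \<Otimes>\<^sub>M lborel))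
      + (\<integral>\<^sup>+z. (case z of (x, y) \<Rightarrow> u x * v y * \<kappa> * g (x, y)) \<partial>(lborel \<Otimes>\<^sub>M lborel))"
    by (subst nn_integral_count_space_finite)
       (auto simp: UNIV_bool T_def case_prod_beta' add.commute)
  also have "(\<integral>\<^sup>+z. (case z of (x, y) \<Rightarrow> m x * p y * g (x, x)) \<partial>(lborel \<Otimes>\<^sub>M lborel))
      = (\<integral>\<^sup>+x. m x * g (x, x) \<partial>lborel)"
  proof (subst lborel.nn_integral_fst[symmetric])
    show "(\<integral>\<^sup>+x. \<integral>\<^sup>+y. (case (x, y) of (x, y) \<Rightarrow> m x * p y * g (x, x)) \<partial>lborel \<partial>lborel)
      = (\<integral>\<^sup>+x. m x * g (x, x) \<partial>lborel)"
    proof (intro nn_integral_cong)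
      fix x :: real
      have "(\<integral>\<^sup>+y. m x * p y * g (x, x) \<partial>lborel) = (\<integral>\<^sup>+y. (m x * g (x, x)) * p y \<partial>lborel)"
        by (simp add: mult_ac)
      also have "\<dots> = m x * g (x, x)"
        by (subst nn_integral_cmult) (auto simp: p1)
      finally show "(\<integral>\<^sup>+y. (case (x, y) of (x, y) \<Rightarrow> m x * p y * g (x, x)) \<partial>lborel) = m x * g (x, x)"
        by simp
    qed
  qed (auto simp: case_prod_beta)
  also have "(\<integral>\<^sup>+z. (case z of (x, y) \<Rightarrow> u x * v y * \<kappa> * g (x, y)) \<partial>(lborel \<Otimes>\<^sub>M lborel))
      = (\<integral>\<^sup>+x. u x * (\<integral>\<^sup>+y. v y * \<kappa> * g (x, y) \<partial>lborel) \<partial>lborel)"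
    by (subst lborel.nn_integral_fst[symmetric])
       (auto simp: case_prod_beta nn_integral_cmult[symmetric] mult.assoc)
  finally show ?thesis .
qed

text \<open>The residuals p - min(p, r) and r - min(p, r) have equal mass \<open>\<delta>\<close>,
  so they can be coupled independently with normalisation 1/\<open>\<delta>\<close>. Only they cost
  anything, and they add up to |p - r|. Working in \<open>ennreal\<close> admits infinite first
  moments.\<close>

lemma W1_density_le:
  fixes p r :: "real \<Rightarrow> real"
  assumes [measurable]: "p \<in> borel_measurable borel" "r \<in> borel_measurable borel"
    and p0: "\<And>x. 0 \<le> p x" and r0: "\<And>x. 0 \<le> r x"
    and p1: "(\<integral>\<^sup>+x. ennreal (p x) \<partial>lborel) = 1" and r1: "(\<integral>\<^sup>+x. ennreal (r x) \<partial>lborel) = 1"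
  shows "W1 (density lborel p) (density lborel r) \<le> (\<integral>\<^sup>+x. ennreal (\<bar>x\<bar> * \<bar>p x - r x\<bar>) \<partial>lborel)"
proof -
  define m where "m x = ennreal (min (p x) (r x))" for x
  define u where "u x = ennreal (p x - min (p x) (r x))" for x
  define v where "v x = ennreal (r x - min (p x) (r x))" for x
  have [measurable]: "m \<in> borel_measurable borel" "u \<in> borel_measurable borel" "v \<in> borel_measurable borel"
    unfolding m_def u_def v_def by measurable
  define \<delta> where "\<delta> = (\<integral>\<^sup>+x. u x \<partial>lborel)"
  have mu: "m x + u x = ennreal (p x)" and mv: "m x + v x = ennreal (r x)" for x
    using p0[of x] r0[of x] by (auto simp: m_def u_def v_def ennreal_plus[symmetric] simp del: ennreal_plus)
  have 1: "(\<integral>\<^sup>+x. m x \<partial>lborel) + \<delta> = 1"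
    unfolding \<delta>_def by (subst nn_integral_add[symmetric]) (auto simp: mu p1)
  have 2: "(\<integral>\<^sup>+x. m x \<partial>lborel) + (\<integral>\<^sup>+x. v x \<partial>lborel) = 1"
    by (subst nn_integral_add[symmetric]) (auto simp: mv r1)
  have mfin: "(\<integral>\<^sup>+x. m x \<partial>lborel) \<noteq> \<infinity>" and dfin: "\<delta> \<noteq> \<infinity>"
    using 1 by (auto simp: )
  have v\<delta>: "(\<integral>\<^sup>+x. v x \<partial>lborel) = \<delta>"
    using 1 2 mfin by (metis ennreal_add_left_cancel infinity_ennreal_def)
  \<comment> \<open>If \<open>\<delta>\<close> = 0, both residuals vanish almost everywhere. With
    the value 0 for \<open>\<kappa>\<close> the cancellations \<open>AEu\<close> and
    \<open>AEv\<close> then still hold, but only almost everywhere.\<close>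
  define \<kappa> where "\<kappa> = (if \<delta> = 0 then 0 else 1 / \<delta>)"
  have \<kappa>: "\<delta> \<noteq> 0 \<Longrightarrow> \<delta> * \<kappa> = 1"
    using dfin by (simp add: \<kappa>_def ennreal_times_divide ennreal_divide_self less_top)
  have AEu: "AE x in lborel. u x * (\<delta> * \<kappa>) = u x"
  proof (cases "\<delta> = 0")
    case True
    then have "AE x in lborel. u x = 0" unfolding \<delta>_def by (subst (asm) nn_integral_0_iff_AE) auto
    then show ?thesis by eventually_elim simp
  qed (simp add: \<kappa>)
  have AEv: "AE x in lborel. v x * (\<delta> * \<kappa>) = v x"
  proof (cases "\<delta> = 0")
    case True
    then have "AE x in lborel. v x = 0" unfolding v\<delta>[symmetric] by (subst (asm) nn_integral_0_iff_AE) auto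
    then show ?thesis by eventually_elim simp
  qed (simp add: \<kappa>)
  define \<gamma> where "\<gamma> = distr (density (count_space (UNIV :: bool set) \<Otimes>\<^sub>M (lborel \<Otimes>\<^sub>M lborel))
      (\<lambda>(b, x, y). if b then m x * ennreal (p y) else u x * v y * \<kappa>)) (borel \<Otimes>\<^sub>M borel)
      (\<lambda>(b, x, y). if b then (x, x) else (x, y))"
  have G: "(\<integral>\<^sup>+z. g z \<partial>\<gamma>) = (\<integral>\<^sup>+x. m x * g (x, x) \<partial>lborel)
      + (\<integral>\<^sup>+x. u x * (\<integral>\<^sup>+y. v y * \<kappa> * g (x, y) \<partial>lborel) \<partial>lborel)"
    if [measurable]: "g \<in> borel_measurable (borel \<Otimes>\<^sub>M borel)" for g
    unfolding \<gamma>_def by (rule nn_integral_common_part_coupling) (use p1 in auto)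
  have sets[simp, measurable_cong]: "sets \<gamma> = sets (borel \<Otimes>\<^sub>M borel)" by (simp add: \<gamma>_def)
  have inner: "(\<integral>\<^sup>+y. v y * \<kappa> \<partial>lborel) = \<delta> * \<kappa>"
    by (simp add: nn_integral_multc v\<delta>)
  have Gfst: "(\<integral>\<^sup>+z. h (fst z) \<partial>\<gamma>) = (\<integral>\<^sup>+x. p x * h x \<partial>lborel)" 
    and Gu: "(\<integral>\<^sup>+x. u x * (\<integral>\<^sup>+y. v y * \<kappa> * h x \<partial>lborel) \<partial>lborel) = (\<integral>\<^sup>+x. u x * h x \<partial>lborel)"
    if [measurable]: "h \<in> borel_measurable borel" for h :: "real \<Rightarrow> ennreal"
  proof -
    have "(\<integral>\<^sup>+y. v y * \<kappa> * h x \<partial>lborel) = \<delta> * \<kappa> * h x" for x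
      by (subst nn_integral_multc) (auto simp: inner)
    then have "(\<integral>\<^sup>+x. u x * (\<integral>\<^sup>+y. v y * \<kappa> * h x \<partial>lborel) \<partial>lborel) = (\<integral>\<^sup>+x. (u x * (\<delta> * \<kappa>)) * h x \<partial>lborel)"
      by (simp add: mult_ac)
    also have "\<dots> = (\<integral>\<^sup>+x. u x * h x \<partial>lborel)"
      by (rule nn_integral_cong_AE) (use AEu in \<open>eventually_elim, simp\<close>)
    finally show *: "(\<integral>\<^sup>+x. u x * (\<integral>\<^sup>+y. v y * \<kappa> * h x \<partial>lborel) \<partial>lborel) = (\<integral>\<^sup>+x. u x * h x \<partial>lborel)" .
    show "(\<integral>\<^sup>+z. h (fst z) \<partial>\<gamma>) = (\<integral>\<^sup>+x. p x * h x \<partial>lborel)"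
      by (subst G) (auto simp: * nn_integral_add[symmetric] distrib_right[symmetric] mu)
  qed
  have Gsnd: "(\<integral>\<^sup>+z. h (snd z) \<partial>\<gamma>) = (\<integral>\<^sup>+x. r x * h x \<partial>lborel)" 
    and Gv: "(\<integral>\<^sup>+x. u x * (\<integral>\<^sup>+y. v y * \<kappa> * h y \<partial>lborel) \<partial>lborel) = (\<integral>\<^sup>+y. v y * h y \<partial>lborel)"
    if [measurable]: "h \<in> borel_measurable borel" for h :: "real \<Rightarrow> ennreal"
  proof -
    have "(\<integral>\<^sup>+x. u x * (\<integral>\<^sup>+y. v y * \<kappa> * h y \<partial>lborel) \<partial>lborel) = \<delta> * (\<integral>\<^sup>+y. v y * \<kappa> * h y \<partial>lborel)"
      by (simp add: nn_integral_multc \<delta>_def)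
    also have "\<dots> = (\<integral>\<^sup>+y. (v y * (\<delta> * \<kappa>)) * h y \<partial>lborel)"
      by (subst nn_integral_cmult[symmetric]) (auto simp: mult_ac)
    also have "\<dots> = (\<integral>\<^sup>+y. v y * h y \<partial>lborel)"
      by (rule nn_integral_cong_AE) (use AEv in \<open>eventually_elim, simp\<close>)
    finally show *: "(\<integral>\<^sup>+x. u x * (\<integral>\<^sup>+y. v y * \<kappa> * h y \<partial>lborel) \<partial>lborel) = (\<integral>\<^sup>+x. v x * h x \<partial>lborel)" .
    show "(\<integral>\<^sup>+z. h (snd z) \<partial>\<gamma>) = (\<integral>\<^sup>+x. r x * h x \<partial>lborel)"
      by (subst G) (auto simp: * nn_integral_add[symmetric] distrib_right[symmetric] mv)
  qed
  have "emeasure \<gamma> (space \<gamma>) = 1"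
    using Gfst[of "\<lambda>_. 1"] by (simp add: p1)
  then have "prob_space \<gamma>" by (rule prob_spaceI)
  moreover have "distr \<gamma> borel fst = density lborel p"
  proof (rule measure_eqI)
    fix A assume "A \<in> sets (distr \<gamma> borel fst)"
    then have [measurable]: "A \<in> sets borel" by simp
    have "emeasure (distr \<gamma> borel fst) A = (\<integral>\<^sup>+z. indicator A z \<partial>distr \<gamma> borel fst)" by simp
    also have "\<dots> = (\<integral>\<^sup>+z. indicator A (fst z) \<partial>\<gamma>)" by (rule nn_integral_distr) measurable
    also have "\<dots> = emeasure (density lborel p) A" by (simp add: Gfst emeasure_density)
    finally show "emeasure (distr \<gamma> borel fst) A = emeasure (density lborel p) A" .
  qed simp
  moreover have "distr \<gamma> borel snd = density lborel r"
  proof (rule measure_eqI)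
    fix A assume "A \<in> sets (distr \<gamma> borel snd)"
    then have [measurable]: "A \<in> sets borel" by simp
    have "emeasure (distr \<gamma> borel snd) A = (\<integral>\<^sup>+z. indicator A z \<partial>distr \<gamma> borel snd)" by simp
    also have "\<dots> = (\<integral>\<^sup>+z. indicator A (snd z) \<partial>\<gamma>)" by (rule nn_integral_distr) measurable
    also have "\<dots> = emeasure (density lborel r) A" by (simp add: Gsnd emeasure_density)
    finally show "emeasure (distr \<gamma> borel snd) A = emeasure (density lborel r) A" .
  qed simp
  ultimately have "\<gamma> \<in> couplings (density lborel p) (density lborel r)"
    by (simp add: couplings_def)
  then have "W1 (density lborel p) (density lborel r) \<le> (\<integral>\<^sup>+z. ennreal \<bar>fst z - snd z\<bar> \<partial>\<gamma>)"
    unfolding W1_def by (rule INF_lower)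
  also have "\<dots> = (\<integral>\<^sup>+x. u x * (\<integral>\<^sup>+y. v y * \<kappa> * ennreal \<bar>x - y\<bar> \<partial>lborel) \<partial>lborel)"
    by (subst G) auto
  \<comment> \<open>Since |x - y| <= |x| + |y|, each summand depends on one coordinate only, and the
    other one integrates out by \<open>Gu\<close> or \<open>Gv\<close>.\<close>
  also have "\<dots> \<le> (\<integral>\<^sup>+x. u x * (\<integral>\<^sup>+y. v y * \<kappa> * ennreal \<bar>x\<bar> \<partial>lborel)
      + u x * (\<integral>\<^sup>+y. v y * \<kappa> * ennreal \<bar>y\<bar> \<partial>lborel) \<partial>lborel)"
  proof (rule nn_integral_mono)
    fix x :: real
    have "(\<integral>\<^sup>+y. v y * \<kappa> * ennreal \<bar>x - y\<bar> \<partial>lborel) \<le> (\<integral>\<^sup>+y. v y * \<kappa> * ennreal \<bar>x\<bar> + v y * \<kappa> * ennreal \<bar>y\<bar> \<partial>lborel)"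
      by (intro nn_integral_mono)
         (auto simp: distrib_left[symmetric] ennreal_plus[symmetric] simp del: ennreal_plus intro!: mult_left_mono ennreal_leI)
    also have "\<dots> = (\<integral>\<^sup>+y. v y * \<kappa> * ennreal \<bar>x\<bar> \<partial>lborel) + (\<integral>\<^sup>+y. v y * \<kappa> * ennreal \<bar>y\<bar> \<partial>lborel)"
      by (rule nn_integral_add) auto
    finally show "u x * (\<integral>\<^sup>+y. v y * \<kappa> * ennreal \<bar>x - y\<bar> \<partial>lborel) \<le>
       u x * (\<integral>\<^sup>+y. v y * \<kappa> * ennreal \<bar>x\<bar> \<partial>lborel) + u x * (\<integral>\<^sup>+y. v y * \<kappa> * ennreal \<bar>y\<bar> \<partial>lborel)"
      unfolding distrib_left[symmetric] by (rule mult_left_mono) simp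
  qed
  also have "\<dots> = (\<integral>\<^sup>+x. u x * ennreal \<bar>x\<bar> \<partial>lborel) + (\<integral>\<^sup>+x. v x * ennreal \<bar>x\<bar> \<partial>lborel)"
    by (subst nn_integral_add) (auto simp: Gu Gv)
  also have "\<dots> = (\<integral>\<^sup>+x. (u x + v x) * ennreal \<bar>x\<bar> \<partial>lborel)"
    by (subst nn_integral_add[symmetric]) (auto simp: distrib_right)
  also have "\<dots> = (\<integral>\<^sup>+x. ennreal (\<bar>x\<bar> * \<bar>p x - r x\<bar>) \<partial>lborel)"
  proof (rule nn_integral_cong)
    fix x
    have "u x + v x = ennreal \<bar>p x - r x\<bar>"
      by (auto simp: u_def v_def ennreal_plus[symmetric] min_def simp del: ennreal_plus)
    then show "(u x + v x) * ennreal \<bar>x\<bar> = ennreal (\<bar>x\<bar> * \<bar>p x - r x\<bar>)"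
      by (simp add: ennreal_mult mult.commute)
  qed
  finally show ?thesis .
qed

section \<open>Hermite polynomials under the Gaussian measure\<close>

text \<open>The probabilists' Hermite polynomials. The recursion applies x - d/dx, the operator to
  which Stein's identity is adapted.\<close>

fun hermite_poly :: "nat \<Rightarrow> real poly" where
  "hermite_poly 0 = 1"
| "hermite_poly (Suc k) = [:0, 1:] * hermite_poly k - pderiv (hermite_poly k)"

lemma pderiv_hermite_poly: "pderiv (hermite_poly (Suc k)) = smult (of_nat (Suc k)) (hermite_poly k)"
proof (induction k)
  case 0
  show ?case by (simp add: pderiv_pCons pderiv_diff)
next
  case (Suc k)
  have "pderiv (hermite_poly (Suc (Suc k)))
      = hermite_poly (Suc k) + [:0, 1:] * pderiv (hermite_poly (Suc k)) - pderiv (pderiv (hermite_poly (Suc k)))"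
    by (simp only: hermite_poly.simps(2)[of "Suc k"] pderiv_diff pderiv_mult) (simp add: pderiv_pCons)
  also have "\<dots> = hermite_poly (Suc k) + smult (of_nat (Suc k)) ([:0, 1:] * hermite_poly k - pderiv (hermite_poly k))"
    unfolding Suc.IH by (simp only: pderiv_smult smult_diff_right mult_smult_right add_diff_eq)
  also have "\<dots> = smult (of_nat (Suc (Suc k))) (hermite_poly (Suc k))"
    by (simp only: hermite_poly.simps(2)[symmetric] of_nat_Suc[of "Suc k"] smult_add_left smult_1_left)
  finally show ?case .
qed

lemma poly_hermite_poly_Suc_Suc:
  "poly (hermite_poly (Suc (Suc k))) y
     = y * poly (hermite_poly (Suc k)) y - real (Suc k) * poly (hermite_poly k) y"
  by (subst hermite_poly.simps(2)) (simp only: pderiv_hermite_poly, simp)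

text \<open>The expectation under a standard normal variable Z, taken on polynomials only so that
  integrability is automatic.\<close>

definition gauss_E :: "real poly \<Rightarrow> real" where
  "gauss_E p = (\<integral>x. std_normal_density x * poly p x \<partial>lborel)"

lemma integrable_std_normal_poly [simp, intro]:
  "integrable lborel (\<lambda>x. std_normal_density x * poly p x)"
  unfolding poly_altdef sum_distrib_left
  by (intro Bochner_Integration.integrable_sum)
     (use integrable_std_normal_moment in \<open>simp add: mult.left_commute\<close>)

lemma gauss_E_add: "gauss_E (p + q) = gauss_E p + gauss_E q"
  unfolding gauss_E_def poly_add distrib_left by (rule Bochner_Integration.integral_add) auto

lemma gauss_E_smult: "gauss_E (smult a p) = a * gauss_E p"
  unfolding gauss_E_def poly_smult by (simp add: mult.left_commute)

lemma gauss_E_diff: "gauss_E (p - q) = gauss_E p - gauss_E q"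
  unfolding gauss_E_def poly_diff right_diff_distrib by (rule Bochner_Integration.integral_diff) auto

lemma gauss_E_0 [simp]: "gauss_E 0 = 0"
  by (simp add: gauss_E_def)

lemma gauss_E_nonneg: "(\<And>x. 0 \<le> poly p x) \<Longrightarrow> 0 \<le> gauss_E p"
  unfolding gauss_E_def by (intro Bochner_Integration.integral_nonneg) auto

text \<open>Read off from the explicit even moments (2j)! / (2^j j!); the odd moments vanish on both
  sides. This is Stein's identity for a monomial.\<close>

lemma gauss_E_monom: "gauss_E (monom 1 (Suc (Suc k))) = real (Suc k) * gauss_E (monom 1 k)"
proof (cases "even k")
  case True
  then obtain j where k: "k = 2 * j" by (elim evenE)
  have 1: "gauss_E (monom 1 (2 * j)) = fact (2 * j) / (2 ^ j * fact j)" for j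
    unfolding gauss_E_def using integral_std_normal_moment_even[of j] by (simp add: poly_monom)
  have 2: "Suc (Suc k) = 2 * Suc j" using k by simp
  have "gauss_E (monom 1 (Suc (Suc k))) = fact (2 * Suc j) / (2 ^ Suc j * fact (Suc j))"
    unfolding 2 1 ..
  also have "\<dots> = real (Suc k) * (fact (2 * j) / (2 ^ j * fact j))"
  proof -
    have "fact (2 * Suc j) = (2 * real j + 2) * ((2 * real j + 1) * fact (2 * j))"
      by (simp add: algebra_simps)
    moreover have "2 ^ Suc j * fact (Suc j) = (2 * real j + 2) * (2 ^ j * fact j)"
      by (simp add: algebra_simps)
    ultimately show ?thesis
      by (simp only: mult_divide_mult_cancel_left_if) (simp add: k add_nonneg_eq_0_iff)
  qed
  finally show ?thesis using 1[of j] k by simp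
next
  case False
  then obtain j where k: "k = 2 * j + 1" by (elim oddE)
  have 1: "gauss_E (monom 1 (2 * j + 1)) = 0" for j
    unfolding gauss_E_def using integral_std_normal_moment_odd[of j] by (simp add: poly_monom)
  show ?thesis using 1[of j] 1[of "Suc j"] k by simp
qed

text \<open>Stein's identity E Z p(Z) = E p'(Z). Both sides are linear in \<open>p\<close>, and on
  monomials it is the recursion of the moments, so integration by parts is avoided.\<close>

lemma gauss_E_stein: "gauss_E ([:0, 1:] * p) = gauss_E (pderiv p)"
proof -
  have m: "gauss_E ([:0, 1:] * monom 1 k) = gauss_E (pderiv (monom 1 k))" for k
  proof (cases k)
    case 0
    then show ?thesis
      using integral_std_normal_moment_odd[of 0] by (simp add: gauss_E_def pderiv_monom)
  next
    case (Suc j)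
    have "[:0, 1:] * monom (1::real) k = monom 1 (Suc k)"
      by (simp add: monom_Suc)
    moreover have "pderiv (monom (1::real) k) = smult (real (Suc j)) (monom 1 j)"
      using Suc by (simp add: pderiv_monom smult_monom)
    ultimately show ?thesis using gauss_E_monom[of j] Suc by (simp only: gauss_E_smult)
  qed
  have "gauss_E ([:0, 1:] * (\<Sum>i\<le>n. monom (c i) i)) = gauss_E (pderiv (\<Sum>i\<le>n. monom (c i) i))" for c n
  proof (induction n)
    case 0
    show ?case using m[of 0] gauss_E_smult[of "c 0" "[:0, 1:]"] by (simp add: monom_0 pderiv_pCons)
  next
    case (Suc n)
    have "monom (c (Suc n)) (Suc n) = smult (c (Suc n)) (monom 1 (Suc n))"
      by (simp add: smult_monom)
    then show ?case
      using Suc.IH m[of "Suc n"]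
      by (simp only: sum.atMost_Suc distrib_left pderiv_add gauss_E_add mult_smult_right pderiv_smult gauss_E_smult)
  qed
  from this[of "coeff p" "degree p"] show ?thesis
    by (simp only: poly_as_sum_of_monoms)
qed

text \<open>He_k(z + s) as a polynomial in z. With s = \<open>\<sigma>\<close> and x =
  \<open>\<sigma>\<close> z this is the factor He_k(x/\<open>\<sigma>\<close> +
  \<open>\<sigma>\<close>) of the smoothed density.\<close>

definition hermite_shift :: "real \<Rightarrow> nat \<Rightarrow> real poly" where
  "hermite_shift s k = pcompose (hermite_poly k) [:s, 1:]"

lemma hermite_shift_Suc:
  "hermite_shift s (Suc k) = [:0, 1:] * hermite_shift s k + smult s (hermite_shift s k) - pderiv (hermite_shift s k)"
  unfolding hermite_shift_def hermite_poly.simps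
  by (simp add: pcompose_diff pcompose_mult pcompose_pCons pderiv_pcompose pderiv_pCons algebra_simps)

lemma pderiv_hermite_shift:
  "pderiv (hermite_shift s (Suc k)) = smult (of_nat (Suc k)) (hermite_shift s k)"
  unfolding hermite_shift_def pderiv_pcompose pderiv_hermite_poly
  by (simp add: pderiv_pCons pcompose_smult del: of_nat_Suc)

text \<open>Write H, J for the polynomials of index k, k + 1. Expanding one factor J by its
  recursion leaves E[Z H J] + s E[H J] - E[H' J]. Stein's identity turns the first term into E[H' J]
  + (k + 1) E[H^2], so the derivative terms cancel. The cross term is absorbed by 2 s H J <= J^2 +
  s^2 H^2, which costs the factor 2.\<close>

lemma gauss_E_hermite_shift_step:
  "gauss_E ((hermite_shift s (Suc k))^2) \<le> (2 * (real k + 1) + s^2) * gauss_E ((hermite_shift s k)^2)"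
proof -
  let ?H = "hermite_shift s k" and ?J = "hermite_shift s (Suc k)"
  have "gauss_E (?J^2) = gauss_E ([:0, 1:] * (?H * ?J)) + s * gauss_E (?H * ?J) - gauss_E (pderiv ?H * ?J)"
    unfolding gauss_E_smult[symmetric] gauss_E_add[symmetric] gauss_E_diff[symmetric]
    by (rule arg_cong[where f = gauss_E]) (subst (1) power2_eq_square, subst (1) hermite_shift_Suc, simp add: algebra_simps)
  also have "gauss_E ([:0, 1:] * (?H * ?J)) = gauss_E (pderiv ?H * ?J) + (real k + 1) * gauss_E (?H^2)"
    unfolding gauss_E_stein pderiv_mult pderiv_hermite_shift
    by (simp add: gauss_E_add gauss_E_smult power2_eq_square mult.commute del: of_nat_Suc)
  finally have 1: "gauss_E (?J^2) = (real k + 1) * gauss_E (?H^2) + s * gauss_E (?H * ?J)"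
    by simp
  have "0 \<le> gauss_E ((?J - smult s ?H)^2)" by (rule gauss_E_nonneg) simp
  also have "(?J - smult s ?H)^2 = ?J^2 + smult (s^2) (?H^2) - smult (2 * s) (?H * ?J)"
    by (rule poly_eq_poly_eq_iff[THEN iffD1], rule ext) (simp add: power2_eq_square algebra_simps)
  finally have "2 * s * gauss_E (?H * ?J) \<le> gauss_E (?J^2) + s^2 * gauss_E (?H^2)"
    by (simp add: gauss_E_add gauss_E_diff gauss_E_smult)
  with 1 show ?thesis by (simp add: algebra_simps)
qed

text \<open>The product of the factors \<open>2 j + s\<^sup>2\<close> is at most \<open>4\<^sup>k k!\<close> up to the finitely many
  factors with \<open>2 j < s\<^sup>2\<close>.\<close>
lemma gauss_E_hermite_shift_bound:
  obtains C where "0 < C" "\<And>k. gauss_E ((hermite_shift s k)^2) \<le> C\<^sup>2 * (4 ^ k * fact k)"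
proof -
  let ?u = "\<lambda>k. gauss_E ((hermite_shift s k)^2) / (4 ^ k * fact k)"
  \<comment> \<open>From this index on s^2 <= 2 (k + 1), so the step factor is at most 4 (k + 1) and
    the normalised moments no longer increase. The finitely many earlier ones go into the
    maximum.\<close>
  obtain N :: nat where N: "s^2 / 2 \<le> real N" by (meson real_arch_simple)
  have dec: "?u (Suc k) \<le> ?u k" if "N \<le> k" for k
  proof -
    have "2 * (real k + 1) + s^2 \<le> 4 * (real k + 1)" using N that by simp
    then have "(2 * (real k + 1) + s^2) * gauss_E ((hermite_shift s k)^2) \<le> 4 * (real k + 1) * gauss_E ((hermite_shift s k)^2)"
      by (intro mult_right_mono gauss_E_nonneg) auto
    with gauss_E_hermite_shift_step[of s k]
    have "gauss_E ((hermite_shift s (Suc k))^2) \<le> 4 * (real k + 1) * gauss_E ((hermite_shift s k)^2)" by linarith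
    from divide_right_mono[OF this, of "4 * (real k + 1) * (4 ^ k * fact k)"]
    have "gauss_E ((hermite_shift s (Suc k))^2) / (4 * (real k + 1) * (4 ^ k * fact k))
        \<le> (4 * (real k + 1) * gauss_E ((hermite_shift s k)^2)) / (4 * (real k + 1) * (4 ^ k * fact k))"
      by simp
    moreover have "4 ^ Suc k * fact (Suc k) = 4 * (real k + 1) * (4 ^ k * fact k)"
      by (simp add: algebra_simps)
    ultimately show ?thesis by (simp only: mult_divide_mult_cancel_left_if split: if_splits) simp
  qed
  define A where "A = 1 + Max (?u ` {..N})"
  have nn: "0 \<le> ?u k" for k by (intro divide_nonneg_pos gauss_E_nonneg) auto
  have bd: "?u k \<le> Max (?u ` {..N})" if "k \<le> N" for k using that by (intro Max_ge) auto
  have A: "?u k \<le> A" for k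
  proof (cases "k \<le> N")
    case False
    then have "N \<le> k" by simp
    then have "?u k \<le> ?u N"
    proof (induction k rule: dec_induct)
      case (step k)
      then show ?case using dec[of k] by linarith
    qed simp
    moreover have "?u N \<le> Max (?u ` {..N})" by (rule bd) simp
    ultimately show ?thesis unfolding A_def by linarith
  next
    case True
    then show ?thesis using bd[of k] unfolding A_def by linarith
  qed
  have "0 < A" using nn[of 0] bd[of 0] by (simp add: A_def)
  show ?thesis
  proof (rule that[of "sqrt A"])
    show "gauss_E ((hermite_shift s k)^2) \<le> (sqrt A)\<^sup>2 * (4 ^ k * fact k)" for k
      using A[of k] \<open>0 < A\<close> by (simp add: pos_divide_le_eq)
  qed (use \<open>0 < A\<close> in simp)
qed

text \<open>Convergence and coefficients are treated separately. The sum is the Cauchy product of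
  the absolutely convergent series of exp(y z) and exp(-z^2/2). As a formal power series this
  product F satisfies F' = (y - X) F, which is the three-term recurrence of He_k / k!.\<close>

lemma hermite_poly_sums:
  "(\<lambda>k. poly (hermite_poly k) y / fact k * z ^ k) sums exp (y * z - z\<^sup>2 / 2)"
proof -
  \<comment> \<open>The Taylor coefficients of exp(-z^2/2); the odd ones are zero.\<close>
  define b :: "nat \<Rightarrow> real" where "b j = (if even j then (- 1 / 2) ^ (j div 2) / fact (j div 2) else 0)" for j
  define F where "F = fps_exp y * Abs_fps b"
  have bsums: "(\<lambda>j. b j * z ^ j) sums exp (- z\<^sup>2 / 2)"
  proof -
    have "(\<lambda>n. (- z\<^sup>2 / 2) ^ n /\<^sub>R fact n) sums exp (- z\<^sup>2 / 2)" by (rule exp_converges)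
    from sums_if[OF sums_zero this]
    have "(\<lambda>n. if even n then (- z\<^sup>2 / 2) ^ (n div 2) /\<^sub>R fact (n div 2) else 0) sums exp (- z\<^sup>2 / 2)"
      by (simp cong: if_cong)
    also have "(\<lambda>n. if even n then (- z\<^sup>2 / 2) ^ (n div 2) /\<^sub>R fact (n div 2) else 0) = (\<lambda>j. b j * z ^ j)"
    proof
      fix n show "(if even n then (- z\<^sup>2 / 2) ^ (n div 2) /\<^sub>R fact (n div 2) else 0) = b n * z ^ n"
      proof (cases "even n")
        case True
        then obtain m where n: "n = 2 * m" by (elim evenE)
        have "(- z\<^sup>2 / 2) ^ m = ((- 1 / 2) * z\<^sup>2) ^ m"
          by (rule arg_cong[where f = "\<lambda>x. x ^ m"]) (simp only: divide_inverse minus_mult_left[symmetric] mult_1_left mult.commute minus_mult_right)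
        also have "\<dots> = (- 1 / 2) ^ m * z ^ (2 * m)" by (simp only: power_mult_distrib power_mult)
        finally have H: "(- z\<^sup>2 / 2) ^ m = (- 1 / 2) ^ m * z ^ (2 * m)" .
        have e: "even n" "n div 2 = m" by (simp_all add: n)
        show ?thesis unfolding b_def if_P[OF e(1)] e(2) H
          by (simp only: n divide_inverse mult_ac real_scaleR_def)
      qed (simp add: b_def)
    qed
    finally show ?thesis .
  qed
  have babs: "summable (\<lambda>j. norm (b j * z ^ j))"
  proof -
    have "(\<lambda>n. (z\<^sup>2 / 2) ^ n /\<^sub>R fact n) sums exp (z\<^sup>2 / 2)" by (rule exp_converges)
    from sums_if[OF sums_zero this]
    have "summable (\<lambda>n. if even n then (z\<^sup>2 / 2) ^ (n div 2) /\<^sub>R fact (n div 2) else 0)"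
      by (simp cong: if_cong add: sums_iff)
    also have "(\<lambda>n. if even n then (z\<^sup>2 / 2) ^ (n div 2) /\<^sub>R fact (n div 2) else 0) = (\<lambda>j. norm (b j * z ^ j))"
    proof
      fix n show "(if even n then (z\<^sup>2 / 2) ^ (n div 2) /\<^sub>R fact (n div 2) else 0) = norm (b n * z ^ n)"
      proof (cases "even n")
        case True
        then obtain m where n: "n = 2 * m" by (elim evenE)
        have "(z\<^sup>2 / 2) ^ m = ((1 / 2) * \<bar>z\<bar>\<^sup>2) ^ m"
          by (rule arg_cong[where f = "\<lambda>x. x ^ m"]) simp
        also have "\<dots> = (1 / 2) ^ m * \<bar>z\<bar> ^ (2 * m)" by (simp only: power_mult_distrib power_mult)
        finally have H: "(z\<^sup>2 / 2) ^ m = (1 / 2) ^ m * \<bar>z\<bar> ^ (2 * m)" .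
        have e: "even n" "n div 2 = m" using n by auto
        have a: "\<bar>(- 1 / 2 :: real) ^ m\<bar> = (1 / 2) ^ m" by (simp add: power_abs)
        have c: "norm ((- 1 / 2) ^ m / fact m * z ^ n) = \<bar>(- 1 / 2) ^ m\<bar> / \<bar>fact m\<bar> * \<bar>z ^ n\<bar>"
          by (simp only: real_norm_def abs_mult abs_divide)
        have f: "\<bar>fact m :: real\<bar> = fact m" by simp
        show ?thesis unfolding b_def if_P[OF e(1)] e(2) H c a
          by (simp only: n power_abs f real_scaleR_def divide_inverse mult_ac)
      qed (simp add: b_def)
    qed
    finally show ?thesis .
  qed
  have asums: "(\<lambda>i. y ^ i / fact i * z ^ i) sums exp (y * z)"
    using exp_converges[of "y * z"] by (simp add: power_mult_distrib divide_inverse mult_ac)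
  have aabs: "summable (\<lambda>i. norm (y ^ i / fact i * z ^ i))"
    using summable_norm_exp[of "y * z"] by (simp add: power_mult_distrib divide_inverse mult_ac)
  have "(\<lambda>k. \<Sum>i\<le>k. (y ^ i / fact i * z ^ i) * (b (k - i) * z ^ (k - i))) sums
      ((\<Sum>i. y ^ i / fact i * z ^ i) * (\<Sum>j. b j * z ^ j))"
    by (rule Cauchy_product_sums[OF aabs babs])
  also have "(\<Sum>i. y ^ i / fact i * z ^ i) * (\<Sum>j. b j * z ^ j) = exp (y * z - z\<^sup>2 / 2)"
    using asums bsums by (simp add: sums_iff exp_add[symmetric])
  also have "(\<lambda>k. \<Sum>i\<le>k. (y ^ i / fact i * z ^ i) * (b (k - i) * z ^ (k - i))) = (\<lambda>k. fps_nth F k * z ^ k)"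
  proof
    fix k
    have "(y ^ i / fact i * z ^ i) * (b (k - i) * z ^ (k - i)) = (y ^ i / fact i * b (k - i)) * z ^ k" if "i \<le> k" for i
      using that by (simp add: power_add[symmetric])
    then have "(\<Sum>i\<le>k. (y ^ i / fact i * z ^ i) * (b (k - i) * z ^ (k - i)))
        = (\<Sum>i\<le>k. (y ^ i / fact i * b (k - i)) * z ^ k)"
      by (intro sum.cong refl) (simp only: atMost_iff)
    also have "\<dots> = fps_nth F k * z ^ k"
      by (simp only: F_def fps_mult_nth sum_distrib_right atLeast0AtMost fps_exp_def Abs_fps_inverse UNIV_I fps_nth_Abs_fps of_nat_fact)
    finally show "(\<Sum>i\<le>k. (y ^ i / fact i * z ^ i) * (b (k - i) * z ^ (k - i))) = fps_nth F k * z ^ k" .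
  qed
  finally have S: "(\<lambda>k. fps_nth F k * z ^ k) sums exp (y * z - z\<^sup>2 / 2)" .
  have "fps_nth F k = poly (hermite_poly k) y / fact k" for k
  proof -
    \<comment> \<open>The formal version of the derivative of exp(-z^2/2) being -z
      exp(-z^2/2).\<close>
    have dB: "fps_deriv (Abs_fps b) = - fps_X * Abs_fps b"
    proof (rule fps_ext)
      fix n show "fps_nth (fps_deriv (Abs_fps b)) n = fps_nth (- fps_X * Abs_fps b) n"
      proof (cases "odd n")
        case True
        then obtain m where n: "n = 2 * m + 1" by (elim oddE)
        have r: "(2 * M + 2) * (- p / (2 * ((1 + M) * f))) = - (p / f)" if "0 \<le> M" "0 < f" for M p f :: real
        proof -
          have "(2 * M + 2) * (- p / (2 * ((1 + M) * f))) = - ((2 * (1 + M)) * p / (2 * (1 + M) * f))"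
            by (simp add: algebra_simps)
          also have "\<dots> = - (p / f)" using that by (subst mult_divide_mult_cancel_left) auto
          finally show ?thesis .
        qed
        have e: "odd n" "even (n + 1)" "even (n - 1)" "(n + 1) div 2 = Suc m" "(n - 1) div 2 = m" "real (n + 1) = 2 * real m + 2"
          using n by auto
        have g: "(- 1 / 2) * p / ((1 + M) * f) = - p / (2 * ((1 + M) * f))" for p M f :: real
          by simp
        have "b (n + 1) = - ((- 1 / 2) ^ m) / (2 * ((1 + real m) * fact m))"
          unfolding b_def if_P[OF e(2)] e(4) power_Suc fact_Suc by (simp only: of_nat_Suc g)
        moreover have "b (n - 1) = (- 1 / 2) ^ m / fact m"
          unfolding b_def if_P[OF e(3)] e(5) ..
        ultimately have "real (n + 1) * b (n + 1) = - b (n - 1)"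
          by (simp only: e(6)) (rule r, simp_all)
        then show ?thesis using n by (simp only: fps_deriv_nth fps_nth_Abs_fps) (simp add: mult.commute)
      qed (auto simp: b_def elim!: evenE)
    qed
    have "fps_deriv F = fps_const y * F - fps_X * F"
      by (simp add: F_def dB algebra_simps)
    then have "fps_nth (fps_deriv F) n = fps_nth (fps_const y * F - fps_X * F) n" for n by simp
    \<comment> \<open>The case n = 0 is separate because the coefficient of X F at 0 is 0, whereas
      truncated subtraction would make n - 1 equal to 0.\<close>
    then have rec: "real (Suc n) * fps_nth F (Suc n) = y * fps_nth F n - (if n = 0 then 0 else fps_nth F (n - 1))" for n
      by (simp only: fps_deriv_nth fps_sub_nth fps_mult_left_const_nth fps_X_mult_nth Suc_eq_plus1)
    show ?thesis
    proof (induction k rule: induct_nat_012)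
      case 0 show ?case by (simp add: F_def b_def fps_mult_nth)
    next
      case 1 show ?case using rec[of 0] by (simp add: F_def b_def fps_mult_nth)
    next
      case (ge2 k)
      have "real (Suc (Suc k)) * fps_nth F (Suc (Suc k))
          = y * (poly (hermite_poly (Suc k)) y / fact (Suc k)) - poly (hermite_poly k) y / fact k"
        using rec[of "Suc k"] ge2 by simp
      also have "\<dots> = poly (hermite_poly (Suc (Suc k))) y / fact (Suc k)"
        by (simp only: poly_hermite_poly_Suc_Suc fact_Suc diff_divide_distrib) simp
      finally have rec': "real (Suc (Suc k)) * fps_nth F (Suc (Suc k)) = poly (hermite_poly (Suc (Suc k))) y / fact (Suc k)" .
      have "f = p / (c * d)" if "c * f = p / d" "c \<noteq> 0" for f p c d :: real
        using that by (metis divide_divide_eq_left mult.commute nonzero_mult_div_cancel_left)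
      from this[OF rec'] show ?case unfolding fact_Suc[of "Suc k"] by simp
    qed
  qed
  with S show ?thesis by (simp only:)
qed

section \<open>Smoothed Poisson mixtures\<close>

text \<open>In \<open>ennreal\<close> the right-hand side is infinite when convergence is merely
  conditional, so this triangle inequality can be used under an integral without a case
  distinction.\<close>

lemma sums_ennreal_abs_le:
  fixes f :: "nat \<Rightarrow> real"
  assumes "f sums S"
  shows "ennreal \<bar>S\<bar> \<le> (\<Sum>k. ennreal \<bar>f k\<bar>)"
proof (cases "(\<Sum>k. ennreal \<bar>f k\<bar>) = \<top>")
  case False
  then have s: "summable (\<lambda>k. \<bar>f k\<bar>)"
    by (intro summable_suminf_not_top) auto
  then have "\<bar>S\<bar> \<le> (\<Sum>k. \<bar>f k\<bar>)"
    using summable_rabs[OF s] assms by (simp add: sums_iff)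
  then show ?thesis using s by (subst suminf_ennreal2) (auto intro: ennreal_leI)
qed simp

text \<open>The generating function at y = x/\<open>\<sigma>\<close> + \<open>\<sigma>\<close> and z
  = t/\<open>\<sigma>\<close> has exponent x t/\<open>\<sigma>\<close>^2 + t - t^2/(2
  \<open>\<sigma>\<close>^2). The shift of y by \<open>\<sigma>\<close> produces the term t, which
  cancels the exp(-t) of the Poisson weight; the rest completes the square.\<close>

lemma normal_density_shift_sums:
  assumes "\<sigma> > 0"
  shows "(\<lambda>k. normal_density 0 \<sigma> x * poly (hermite_poly k) (x / \<sigma> + \<sigma>) / \<sigma> ^ k * (exp (- t) * t ^ k / fact k))
    sums normal_density t \<sigma> x"
proof -
  have *: "normal_density 0 \<sigma> x * exp (- t) * exp ((x / \<sigma> + \<sigma>) * (t / \<sigma>) - (t / \<sigma>)\<^sup>2 / 2) = normal_density t \<sigma> x"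
  proof -
    have "- (x\<^sup>2 / (2 * \<sigma>\<^sup>2)) - t + ((x / \<sigma> + \<sigma>) * (t / \<sigma>) - (t / \<sigma>)\<^sup>2 / 2) = - ((x - t)\<^sup>2 / (2 * \<sigma>\<^sup>2))"
      using assms by (simp add: field_simps power2_eq_square)
    then have "exp (- (x\<^sup>2 / (2 * \<sigma>\<^sup>2))) * exp (- t) * exp ((x / \<sigma> + \<sigma>) * (t / \<sigma>) - (t / \<sigma>)\<^sup>2 / 2) = exp (- ((x - t)\<^sup>2 / (2 * \<sigma>\<^sup>2)))"
      by (simp only: exp_add[symmetric] diff_conv_add_uminus)
    then show ?thesis by (simp add: normal_density_def)
  qed
  show ?thesis
    using sums_mult[OF hermite_poly_sums[of "x / \<sigma> + \<sigma>" "t / \<sigma>"], of "normal_density 0 \<sigma> x * exp (- t)"]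
    unfolding * by (simp add: power_divide mult_ac)
qed

lemma prob_on_AE:
  assumes "Q \<in> prob_on t" shows "AE \<theta> in Q. 0 \<le> \<theta> \<and> \<theta> \<le> t"
proof -
  interpret prob_space Q using assms by (simp add: prob_on_def)
  have "emeasure Q {0..t} = 1" and s: "sets Q = sets borel" using assms by (auto simp: prob_on_def)
  then have "prob {0..t} = 1" by (simp add: measure_def)
  then have "AE \<theta> in Q. \<theta> \<in> {0..t}" using s by (subst (asm) prob_eq_1) auto
  then show ?thesis by simp
qed

lemma pois_kernel_integrable:
  assumes "Q \<in> prob_on t"
  shows "integrable Q (\<lambda>\<theta>. exp (- \<theta>) * \<theta> ^ k / fact k)"
proof -
  interpret prob_space Q using assms by (simp add: prob_on_def)
  have [measurable_cong]: "sets Q = sets borel" using assms by (auto simp: prob_on_def)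
  have "AE \<theta> in Q. norm (exp (- \<theta>) * \<theta> ^ k / fact k) \<le> t ^ k / fact k"
    using prob_on_AE[OF assms]
  proof eventually_elim
    case (elim \<theta>)
    then have "exp (- \<theta>) * \<theta> ^ k \<le> 1 * t ^ k" by (intro mult_mono power_mono) auto
    then show ?case using elim by (auto simp: divide_right_mono abs_mult)
  qed
  then show ?thesis by (rule integrable_const_bound) measurable
qed

lemma pois_mix_nonneg:
  assumes "Q \<in> prob_on t"
  shows "0 \<le> pois_mix Q k"
  unfolding pois_mix_def
  by (rule integral_nonneg_AE) (use prob_on_AE[OF assms] in \<open>eventually_elim, simp\<close>)

lemma pois_mix_le:
  assumes "Q \<in> prob_on t"
  shows "pois_mix Q k \<le> t ^ k / fact k"
proof -
  interpret prob_space Q using assms by (simp add: prob_on_def)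
  have "AE \<theta> in Q. exp (- \<theta>) * \<theta> ^ k / fact k \<le> t ^ k / fact k"
    using prob_on_AE[OF assms]
  proof eventually_elim
    case (elim \<theta>)
    then have "exp (- \<theta>) * \<theta> ^ k \<le> 1 * t ^ k" by (intro mult_mono power_mono) auto
    then show ?case by (auto simp: divide_right_mono)
  qed
  then have "pois_mix Q k \<le> (\<integral>\<theta>. t ^ k / fact k \<partial>Q)"
    unfolding pois_mix_def using pois_kernel_integrable[OF assms] by (intro integral_mono_AE) auto
  then show ?thesis by (simp add: prob_space)
qed

definition smooth_density :: "real \<Rightarrow> real measure \<Rightarrow> real \<Rightarrow> real" where
  "smooth_density \<sigma> Q x = (\<integral>t. normal_density t \<sigma> x \<partial>Q)"

text \<open>The expansion of the normal density is integrated over \<open>Q\<close> term by term. On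
  [0, t] it is dominated by the same series with absolute values and argument t.\<close>

lemma smooth_density_sums:
  assumes Q: "Q \<in> prob_on t" and \<sigma>: "\<sigma> > 0"
  shows "(\<lambda>k. normal_density 0 \<sigma> x * poly (hermite_poly k) (x / \<sigma> + \<sigma>) / \<sigma> ^ k * pois_mix Q k)
    sums smooth_density \<sigma> Q x"
proof -
  interpret prob_space Q using Q by (simp add: prob_on_def)
  have [measurable_cong]: "sets Q = sets borel" using Q by (auto simp: prob_on_def)
  let ?a = "\<lambda>k. normal_density 0 \<sigma> x * poly (hermite_poly k) (x / \<sigma> + \<sigma>) / \<sigma> ^ k"
  let ?f = "\<lambda>k \<theta>. ?a k * (exp (- \<theta>) * \<theta> ^ k / fact k)"
  \<comment> \<open>A power series converges absolutely strictly inside its region of convergence;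
    the point |t/\<open>\<sigma>\<close>| + 1 only serves as a larger argument.\<close>
  have "summable (\<lambda>k. norm (poly (hermite_poly k) (x / \<sigma> + \<sigma>) / fact k * (t / \<sigma>) ^ k))"
    by (rule powser_insidea[where x = "\<bar>t / \<sigma>\<bar> + 1"]) (use hermite_poly_sums sums_summable in \<open>blast, simp\<close>)
  then have "summable (\<lambda>k. normal_density 0 \<sigma> x * norm (poly (hermite_poly k) (x / \<sigma> + \<sigma>) / fact k * (t / \<sigma>) ^ k))"
    by (rule summable_mult)
  also have "(\<lambda>k. normal_density 0 \<sigma> x * norm (poly (hermite_poly k) (x / \<sigma> + \<sigma>) / fact k * (t / \<sigma>) ^ k))
      = (\<lambda>k. \<bar>?a k\<bar> * (\<bar>t\<bar> ^ k / fact k))"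
    using \<sigma> by (simp add: abs_mult power_divide power_abs mult_ac)
  finally have sm: "summable (\<lambda>k. \<bar>?a k\<bar> * (\<bar>t\<bar> ^ k / fact k))" .
  have bd: "AE \<theta> in Q. \<forall>k. norm (?f k \<theta>) \<le> \<bar>?a k\<bar> * (\<bar>t\<bar> ^ k / fact k)"
    using prob_on_AE[OF Q]
  proof eventually_elim
    case (elim \<theta>)
    show ?case
    proof
      fix k
      have "exp (- \<theta>) * \<theta> ^ k \<le> 1 * \<bar>t\<bar> ^ k" using elim by (intro mult_mono power_mono) auto
      then have "exp (- \<theta>) * \<theta> ^ k / fact k \<le> \<bar>t\<bar> ^ k / fact k" by (simp add: divide_right_mono)
      then show "norm (?f k \<theta>) \<le> \<bar>?a k\<bar> * (\<bar>t\<bar> ^ k / fact k)"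
        unfolding norm_mult using elim by (intro mult_mono) auto
    qed
  qed
  have int: "integrable Q (?f k)" for k
    by (intro integrable_mult_right pois_kernel_integrable[OF Q])
  have "(\<lambda>k. integral\<^sup>L Q (?f k)) sums (\<integral>\<theta>. (\<Sum>k. ?f k \<theta>) \<partial>Q)"
  proof (rule sums_integral[OF int])
    show "AE \<theta> in Q. summable (\<lambda>k. norm (?f k \<theta>))"
      using bd
    proof eventually_elim
      case (elim \<theta>)
      show ?case by (rule summable_comparison_test[OF _ sm]) (use elim in auto)
    qed
    show "summable (\<lambda>k. \<integral>\<theta>. norm (?f k \<theta>) \<partial>Q)"
    proof (rule summable_comparison_test[OF _ sm], intro exI allI impI)
      fix k
      have "(\<integral>\<theta>. norm (?f k \<theta>) \<partial>Q) \<le> (\<integral>\<theta>. \<bar>?a k\<bar> * (\<bar>t\<bar> ^ k / fact k) \<partial>Q)"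
        using bd int by (intro integral_mono_AE integrable_norm) auto
      then show "norm (\<integral>\<theta>. norm (?f k \<theta>) \<partial>Q) \<le> \<bar>?a k\<bar> * (\<bar>t\<bar> ^ k / fact k)"
        by (simp add: prob_space)
    qed
  qed
  also have "(\<lambda>k. integral\<^sup>L Q (?f k)) = (\<lambda>k. ?a k * pois_mix Q k)"
    unfolding pois_mix_def by (rule ext, rule integral_mult_right_zero)
  also have "(\<integral>\<theta>. (\<Sum>k. ?f k \<theta>) \<partial>Q) = smooth_density \<sigma> Q x"
    unfolding smooth_density_def using normal_density_shift_sums[OF \<sigma>, of x] by (simp add: sums_iff)
  finally show ?thesis .
qed

lemma convolution_gauss_eq_density:
  assumes Q: "Q \<in> prob_on t" and \<sigma>: "\<sigma> > 0"
  shows "Q \<star> gauss \<sigma> = density lborel (\<lambda>x. ennreal (smooth_density \<sigma> Q x))"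
    and "smooth_density \<sigma> Q \<in> borel_measurable borel"
    and "(\<integral>\<^sup>+x. ennreal (smooth_density \<sigma> Q x) \<partial>lborel) = 1"
proof -
  interpret Q: prob_space Q using Q by (simp add: prob_on_def)
  have sQ [simp, measurable_cong]: "sets Q = sets borel" using Q by (auto simp: prob_on_def)
  interpret G: prob_space "gauss \<sigma>" unfolding gauss_def using prob_space_normal_density[OF \<sigma>] by simp
  have sG [simp, measurable_cong]: "sets (gauss \<sigma>) = sets borel" by (simp add: gauss_def)
  interpret P: pair_sigma_finite Q "lborel :: real measure" ..
  have [measurable]: "(\<lambda>z. normal_density (snd z) \<sigma> (fst z)) \<in> borel_measurable (borel \<Otimes>\<^sub>M borel)"
    "(\<lambda>z. normal_density (fst z) \<sigma> (snd z)) \<in> borel_measurable (borel \<Otimes>\<^sub>M borel)"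
    unfolding normal_density_def by measurable
  have sd: "ennreal (smooth_density \<sigma> Q x) = (\<integral>\<^sup>+t. ennreal (normal_density t \<sigma> x) \<partial>Q)" for x
  proof -
    have "integrable Q (\<lambda>t. normal_density t \<sigma> x)"
      by (rule Q.integrable_const_bound[where B = "1 / sqrt (2 * pi * \<sigma>\<^sup>2)"])
         (auto simp: normal_density_def intro!: divide_right_mono)
    then show ?thesis unfolding smooth_density_def by (subst nn_integral_eq_integral) auto
  qed
  show m [measurable]: "smooth_density \<sigma> Q \<in> borel_measurable borel"
    unfolding smooth_density_def by measurable
  have emeas: "emeasure (Q \<star> gauss \<sigma>) A = (\<integral>\<^sup>+x. ennreal (smooth_density \<sigma> Q x) * indicator A x \<partial>lborel)"
    if [measurable]: "A \<in> sets borel" for A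
  proof -
    have "emeasure (Q \<star> gauss \<sigma>) A = (\<integral>\<^sup>+t. \<integral>\<^sup>+y. indicator A (t + y) \<partial>gauss \<sigma> \<partial>Q)"
      by (rule convolution_emeasure') (auto intro: Q.finite_measure_axioms G.finite_measure_axioms)
    also have "\<dots> = (\<integral>\<^sup>+t. \<integral>\<^sup>+x. ennreal (normal_density t \<sigma> x) * indicator A x \<partial>lborel \<partial>Q)"
    proof (rule nn_integral_cong)
      fix t
      have "(\<integral>\<^sup>+y. indicator A (t + y) \<partial>gauss \<sigma>) = (\<integral>\<^sup>+y. ennreal (normal_density 0 \<sigma> y) * indicator A (t + y) \<partial>lborel)"
        unfolding gauss_def by (rule nn_integral_density) measurable
      also have "\<dots> = (\<integral>\<^sup>+x. ennreal (normal_density t \<sigma> x) * indicator A x \<partial>lborel)"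
        by (subst (2) nn_integral_real_affine[where c = 1 and t = t]) (auto simp: normal_density_def)
      finally show "(\<integral>\<^sup>+y. indicator A (t + y) \<partial>gauss \<sigma>) = (\<integral>\<^sup>+x. ennreal (normal_density t \<sigma> x) * indicator A x \<partial>lborel)" .
    qed
    also have "\<dots> = (\<integral>\<^sup>+x. \<integral>\<^sup>+t. ennreal (normal_density t \<sigma> x) * indicator A x \<partial>Q \<partial>lborel)"
    proof -
      have [measurable]: "(\<lambda>z. indicator A (snd z) :: ennreal) \<in> borel_measurable (Q \<Otimes>\<^sub>M lborel)"
        by (rule measurable_compose[OF measurable_snd]) simp
      show ?thesis by (rule P.Fubini'[symmetric]) measurable
    qed
    also have "\<dots> = (\<integral>\<^sup>+x. ennreal (smooth_density \<sigma> Q x) * indicator A x \<partial>lborel)"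
      unfolding sd by (intro nn_integral_cong nn_integral_multc) (auto simp: normal_density_def)
    finally show ?thesis .
  qed
  show eq: "Q \<star> gauss \<sigma> = density lborel (\<lambda>x. ennreal (smooth_density \<sigma> Q x))"
    by (rule measure_eqI) (auto simp: emeas emeasure_density)
  have "prob_space (Q \<star> gauss \<sigma>)"
    unfolding convolution_def
    by (intro prob_space.prob_space_distr prob_space_pair) (auto intro: Q.prob_space_axioms G.prob_space_axioms)
  from prob_space.emeasure_space_1[OF this] emeas[of UNIV]
  show "(\<integral>\<^sup>+x. ennreal (smooth_density \<sigma> Q x) \<partial>lborel) = 1" by simp
qed

lemma borel_measurable_poly_comp [measurable (raw)]:
  fixes f :: "'a \<Rightarrow> real"
  assumes [measurable]: "f \<in> borel_measurable M"
  shows "(\<lambda>x. poly p (f x)) \<in> borel_measurable M"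
  unfolding poly_altdef by measurable

lemma gauss_E_1: "gauss_E 1 = 1"
  unfolding gauss_E_def by simp

lemma nn_integral_std_normal_poly:
  assumes "\<And>x. 0 \<le> poly p x"
  shows "(\<integral>\<^sup>+x. ennreal (std_normal_density x * poly p x) \<partial>lborel) = ennreal (gauss_E p)"
  unfolding gauss_E_def by (rule nn_integral_eq_integral) (use assms in auto)

text \<open>A Cauchy-Schwarz bound in weighted form: |z| |H| <= b z^2 / 2 + H^2 / (2 b) is a
  polynomial majorant, so \<open>gauss_E\<close> applies to it. With E Z^2 = 1 and E H^2 <= b^2 both
  halves give b/2. The factor \<open>\<sigma>\<close> comes from substituting x =
  \<open>\<sigma>\<close> z.\<close>

lemma nn_integral_abs_hermite_le:
  assumes \<sigma>: "\<sigma> > 0" and b: "b > 0" and u: "gauss_E ((hermite_shift \<sigma> k)^2) \<le> b\<^sup>2"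
  shows "(\<integral>\<^sup>+x. ennreal (\<bar>x\<bar> * (normal_density 0 \<sigma> x * \<bar>poly (hermite_poly k) (x / \<sigma> + \<sigma>)\<bar>)) \<partial>lborel) \<le> ennreal (\<sigma> * b)"
proof -
  define p where "p = smult (b / 2) (monom 1 2) + smult (1 / (2 * b)) ((hermite_shift \<sigma> k)^2)"
  have pp: "poly p z = b / 2 * z\<^sup>2 + 1 / (2 * b) * (poly (hermite_poly k) (z + \<sigma>))\<^sup>2" for z
    by (simp add: p_def poly_monom hermite_shift_def poly_pcompose add.commute)
  have ineq: "\<bar>z\<bar> * \<bar>poly (hermite_poly k) (z + \<sigma>)\<bar> \<le> poly p z" for z
  proof -
    let ?h = "\<bar>poly (hermite_poly k) (z + \<sigma>)\<bar>"
    have "0 \<le> (b * \<bar>z\<bar> - ?h)\<^sup>2 / (2 * b)" using b by simp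
    also have "\<dots> = b / 2 * \<bar>z\<bar>\<^sup>2 + 1 / (2 * b) * ?h\<^sup>2 - \<bar>z\<bar> * ?h"
      using b by (simp only: power2_eq_square) (simp add: field_simps)
    finally show ?thesis by (simp add: pp)
  qed
  have dens: "normal_density 0 \<sigma> (\<sigma> * z) * \<sigma> = std_normal_density z" for z
    using \<sigma> by (simp add: normal_density_def std_normal_density_def power_mult_distrib real_sqrt_mult)
  have "(\<integral>\<^sup>+x. ennreal (\<bar>x\<bar> * (normal_density 0 \<sigma> x * \<bar>poly (hermite_poly k) (x / \<sigma> + \<sigma>)\<bar>)) \<partial>lborel)
     = ennreal \<sigma> * (\<integral>\<^sup>+z. ennreal (\<bar>\<sigma> * z\<bar> * (normal_density 0 \<sigma> (\<sigma> * z) * \<bar>poly (hermite_poly k) (z + \<sigma>)\<bar>)) \<partial>lborel)"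
    using \<sigma> by (subst nn_integral_real_affine[where c = \<sigma> and t = 0]) auto
  also have "\<dots> = ennreal \<sigma> * (\<integral>\<^sup>+z. ennreal (std_normal_density z * (\<bar>z\<bar> * \<bar>poly (hermite_poly k) (z + \<sigma>)\<bar>)) \<partial>lborel)"
    using \<sigma> by (simp add: dens[symmetric] abs_mult mult_ac)
  also have "\<dots> \<le> ennreal \<sigma> * (\<integral>\<^sup>+z. ennreal (std_normal_density z * poly p z) \<partial>lborel)"
    by (intro mult_left_mono nn_integral_mono ennreal_leI ineq) auto
  also have "\<dots> = ennreal \<sigma> * ennreal (gauss_E p)"
    using b by (subst nn_integral_std_normal_poly) (auto simp: pp)
  also have "\<dots> \<le> ennreal \<sigma> * ennreal b"
  proof (intro mult_left_mono ennreal_leI)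
    have "gauss_E (monom 1 2) = 1"
      using gauss_E_monom[of 0] gauss_E_1 by (simp add: monom_0 numeral_2_eq_2 one_pCons)
    then have "gauss_E p = b / 2 + gauss_E ((hermite_shift \<sigma> k)^2) / (2 * b)"
      by (simp add: p_def gauss_E_add gauss_E_smult)
    also have "\<dots> \<le> b / 2 + b\<^sup>2 / (2 * b)" using u b by (intro add_left_mono divide_right_mono) auto
    also have "\<dots> = b" using b by (simp add: power2_eq_square)
    finally show "gauss_E p \<le> b" .
  qed simp
  finally show ?thesis using \<sigma> b by (simp add: ennreal_mult)
qed

text \<open>The term k carries \<open>\<sigma>\<close> ^ (-k) from the generating function and 2^k
  sqrt (k!) from the root of the Hermite moment bound. The constant depends on
  \<open>\<sigma>\<close> alone and is fixed before \<open>t\<close>, \<open>Q\<close> and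
  \<open>R\<close>, which makes the final bound uniform.\<close>

lemma W1_smooth_le_series:
  assumes \<sigma>: "\<sigma> > 0"
  obtains C where "0 < C" "\<And>t Q R. Q \<in> prob_on t \<Longrightarrow> R \<in> prob_on t \<Longrightarrow>
     W1_smooth \<sigma> Q R \<le> (\<Sum>k. ennreal (C * ((2 / \<sigma>) ^ k * sqrt (fact k)) * \<bar>pois_mix Q k - pois_mix R k\<bar>))"
proof -
  obtain C where C: "0 < C" "\<And>k. gauss_E ((hermite_shift \<sigma> k)^2) \<le> C\<^sup>2 * (4 ^ k * fact k)"
    using gauss_E_hermite_shift_bound by blast
  have "W1_smooth \<sigma> Q R \<le> (\<Sum>k. ennreal (\<sigma> * C * ((2 / \<sigma>) ^ k * sqrt (fact k)) * \<bar>pois_mix Q k - pois_mix R k\<bar>))"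
    if Q: "Q \<in> prob_on t" and R: "R \<in> prob_on t" for t Q R
  proof -
    let ?D = "\<lambda>k. \<bar>pois_mix Q k - pois_mix R k\<bar>"
    let ?h = "\<lambda>k x. poly (hermite_poly k) (x / \<sigma> + \<sigma>)"
    note [measurable] = convolution_gauss_eq_density(2)[OF Q \<sigma>] convolution_gauss_eq_density(2)[OF R \<sigma>]
    have nn: "0 \<le> smooth_density \<sigma> P x" for P x
      unfolding smooth_density_def by (rule Bochner_Integration.integral_nonneg) auto
    have "W1_smooth \<sigma> Q R \<le> (\<integral>\<^sup>+x. ennreal (\<bar>x\<bar> * \<bar>smooth_density \<sigma> Q x - smooth_density \<sigma> R x\<bar>) \<partial>lborel)"
      unfolding W1_smooth_def convolution_gauss_eq_density(1)[OF Q \<sigma>] convolution_gauss_eq_density(1)[OF R \<sigma>]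
      by (rule W1_density_le) (use nn convolution_gauss_eq_density(3)[OF Q \<sigma>] convolution_gauss_eq_density(3)[OF R \<sigma>] in auto)
    also have "\<dots> \<le> (\<integral>\<^sup>+x. (\<Sum>k. ennreal (?D k / \<sigma> ^ k) * ennreal (\<bar>x\<bar> * (normal_density 0 \<sigma> x * \<bar>?h k x\<bar>))) \<partial>lborel)"
    proof (rule nn_integral_mono)
      fix x
      have "(\<lambda>k. \<bar>x\<bar> * (normal_density 0 \<sigma> x * ?h k x / \<sigma> ^ k * pois_mix Q k - normal_density 0 \<sigma> x * ?h k x / \<sigma> ^ k * pois_mix R k))
        sums (\<bar>x\<bar> * (smooth_density \<sigma> Q x - smooth_density \<sigma> R x))"
        by (intro sums_mult sums_diff smooth_density_sums[OF Q \<sigma>] smooth_density_sums[OF R \<sigma>])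
      from sums_ennreal_abs_le[OF this]
      have "ennreal (\<bar>x\<bar> * \<bar>smooth_density \<sigma> Q x - smooth_density \<sigma> R x\<bar>)
        \<le> (\<Sum>k. ennreal \<bar>\<bar>x\<bar> * (normal_density 0 \<sigma> x * ?h k x / \<sigma> ^ k * pois_mix Q k - normal_density 0 \<sigma> x * ?h k x / \<sigma> ^ k * pois_mix R k)\<bar>)"
        by (simp only: abs_mult abs_idempotent)
      also have "\<dots> = (\<Sum>k. ennreal (?D k / \<sigma> ^ k) * ennreal (\<bar>x\<bar> * (normal_density 0 \<sigma> x * \<bar>?h k x\<bar>)))"
      proof (rule arg_cong[where f = suminf], rule ext)
        fix k
        have "\<bar>\<bar>x\<bar> * (normal_density 0 \<sigma> x * ?h k x / \<sigma> ^ k * pois_mix Q k - normal_density 0 \<sigma> x * ?h k x / \<sigma> ^ k * pois_mix R k)\<bar>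
          = \<bar>\<bar>x\<bar> * (normal_density 0 \<sigma> x * ?h k x / \<sigma> ^ k * (pois_mix Q k - pois_mix R k))\<bar>"
          by (simp only: right_diff_distrib)
        also have "\<dots> = (?D k / \<sigma> ^ k) * (\<bar>x\<bar> * (normal_density 0 \<sigma> x * \<bar>?h k x\<bar>))"
          using \<sigma> by (simp add: abs_mult power_abs)
        finally have e: "\<bar>\<bar>x\<bar> * (normal_density 0 \<sigma> x * ?h k x / \<sigma> ^ k * pois_mix Q k - normal_density 0 \<sigma> x * ?h k x / \<sigma> ^ k * pois_mix R k)\<bar>
          = (?D k / \<sigma> ^ k) * (\<bar>x\<bar> * (normal_density 0 \<sigma> x * \<bar>?h k x\<bar>))" .
        show "ennreal \<bar>\<bar>x\<bar> * (normal_density 0 \<sigma> x * ?h k x / \<sigma> ^ k * pois_mix Q k - normal_density 0 \<sigma> x * ?h k x / \<sigma> ^ k * pois_mix R k)\<bar>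
          = ennreal (?D k / \<sigma> ^ k) * ennreal (\<bar>x\<bar> * (normal_density 0 \<sigma> x * \<bar>?h k x\<bar>))"
          unfolding e by (rule ennreal_mult) (use \<sigma> in auto)
      qed
      finally show "ennreal (\<bar>x\<bar> * \<bar>smooth_density \<sigma> Q x - smooth_density \<sigma> R x\<bar>)
        \<le> (\<Sum>k. ennreal (?D k / \<sigma> ^ k) * ennreal (\<bar>x\<bar> * (normal_density 0 \<sigma> x * \<bar>?h k x\<bar>)))" .
    qed
    also have "\<dots> = (\<Sum>k. ennreal (?D k / \<sigma> ^ k) * (\<integral>\<^sup>+x. ennreal (\<bar>x\<bar> * (normal_density 0 \<sigma> x * \<bar>?h k x\<bar>)) \<partial>lborel))"
      by (subst nn_integral_suminf) (auto simp: nn_integral_cmult)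
    also have "\<dots> \<le> (\<Sum>k. ennreal (?D k / \<sigma> ^ k) * ennreal (\<sigma> * (C * (2 ^ k * sqrt (fact k)))))"
    proof (intro suminf_le mult_left_mono)
      fix k
      have "((2::real) ^ k)\<^sup>2 = (2\<^sup>2) ^ k" by (simp only: power_mult[symmetric] mult.commute)
      then have "(C * (2 ^ k * sqrt (fact k)))\<^sup>2 = C\<^sup>2 * (4 ^ k * fact k)"
        by (simp only: power_mult_distrib) simp
      then show "(\<integral>\<^sup>+x. ennreal (\<bar>x\<bar> * (normal_density 0 \<sigma> x * \<bar>?h k x\<bar>)) \<partial>lborel) \<le> ennreal (\<sigma> * (C * (2 ^ k * sqrt (fact k))))"
        using C by (intro nn_integral_abs_hermite_le \<sigma>) auto
    qed auto
    also have "\<dots> = (\<Sum>k. ennreal (\<sigma> * C * ((2 / \<sigma>) ^ k * sqrt (fact k)) * ?D k))"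
    proof (intro arg_cong[where f = suminf] ext)
      fix k
      have g: "d / s * (\<sigma> * (C * (t * r))) = \<sigma> * C * (t / s * r) * d" for d s t r :: real
        by (simp only: divide_inverse mult_ac)
      show "ennreal (?D k / \<sigma> ^ k) * ennreal (\<sigma> * (C * (2 ^ k * sqrt (fact k))))
          = ennreal (\<sigma> * C * ((2 / \<sigma>) ^ k * sqrt (fact k)) * ?D k)"
        unfolding power_divide g[symmetric] 
        by (rule ennreal_mult[symmetric])
           (intro mult_nonneg_nonneg divide_nonneg_nonneg abs_ge_zero zero_le_power real_sqrt_ge_zero fact_ge_zero less_imp_le[OF \<sigma>] less_imp_le[OF C(1)] zero_le_numeral)+
    qed
    finally show ?thesis .
  qed
  note main = this
  show ?thesis
  proof (rule that[of "\<sigma> * C"])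
    show "0 < \<sigma> * C" using C(1) \<sigma> by simp
  qed (rule main)
qed

section \<open>Hellinger bounds for maximum likelihood\<close>

definition emp_freq :: "nat \<Rightarrow> (nat \<Rightarrow> nat) \<Rightarrow> nat \<Rightarrow> real" where
  "emp_freq n X k = (\<Sum>i<n. if X i = k then 1 else 0) / real n"

text \<open>A cell with \<open>h k = 0\<close> contributes 0, since division by zero gives 0. The
  comparisons below therefore require \<open>h\<close> to be positive at the sample points, so that
  such cells are empty.\<close>

definition chi2_stat :: "nat set \<Rightarrow> (nat \<Rightarrow> real) \<Rightarrow> nat \<Rightarrow> (nat \<Rightarrow> nat) \<Rightarrow> real" where
  "chi2_stat A h n X = (\<Sum>k\<in>A. (emp_freq n X k - h k)\<^sup>2 / h k)"

lemma emp_freq_nonneg: "0 \<le> emp_freq n X k"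
  unfolding emp_freq_def by (intro divide_nonneg_nonneg sum_nonneg) auto

lemma sum_emp_freq:
  assumes "finite A" "\<And>i. i < n \<Longrightarrow> X i \<in> A"
  shows "(\<Sum>k\<in>A. emp_freq n X k * f k) = (\<Sum>i<n. f (X i)) / real n"
proof -
  have "(\<Sum>k\<in>A. emp_freq n X k * f k) = (\<Sum>k\<in>A. \<Sum>i<n. if X i = k then f k else 0) / real n"
    unfolding emp_freq_def times_divide_eq_left sum_divide_distrib[symmetric] sum_distrib_right
    by (intro arg_cong[where f = "\<lambda>x. x / real n"] sum.cong) auto
  also have "(\<Sum>k\<in>A. \<Sum>i<n. if X i = k then f k else 0) = (\<Sum>i<n. \<Sum>k\<in>A. if X i = k then f k else 0)"
    by (rule sum.swap)
  also have "\<dots> = (\<Sum>i<n. f (X i))"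
    by (intro sum.cong refl) (use assms in \<open>simp add: sum.delta\<close>)
  finally show ?thesis .
qed

lemma emp_freq_pos_imp:
  assumes "emp_freq n X k \<noteq> 0" obtains i where "i < n" "X i = k"
proof -
  have "(\<Sum>i<n. if X i = k then 1 else 0 :: real) \<noteq> 0" using assms by (auto simp: emp_freq_def)
  then obtain i where "i \<in> {..<n}" "(if X i = k then 1 else 0 :: real) \<noteq> 0" by (rule sum.not_neutral_contains_not_neutral)
  then show ?thesis using that by (auto split: if_splits)
qed

text \<open>The inequality \<open>ln x \<le> x - 1\<close> is applied to \<open>\<surd>(h' / h\<^sub>n)\<close> and to \<open>h\<^sub>n / h\<close>, where \<open>h\<^sub>n\<close> is the
  empirical frequency; the sum of \<open>h\<^sub>n ln (h' / h)\<close> is nonnegative because \<open>h'\<close> has the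
  larger likelihood.\<close>
lemma hellinger_le_chi2_of_likelihood:
  fixes h h' :: "nat \<Rightarrow> real"
  assumes A: "finite A" and XA: "\<And>i. i < n \<Longrightarrow> X i \<in> A" and hX: "\<And>i. i < n \<Longrightarrow> 0 < h (X i)"
    and n: "0 < n" and h0: "\<And>k. 0 \<le> h k" and h'0: "\<And>k. 0 \<le> h' k"
    and sum': "(\<Sum>k\<in>A. h' k) \<le> 1"
    and like: "(\<Prod>i<n. h (X i)) \<le> (\<Prod>i<n. h' (X i))"
  shows "(\<Sum>k\<in>A. (sqrt (emp_freq n X k) - sqrt (h' k))\<^sup>2) \<le> chi2_stat A h n X + (1 - (\<Sum>k\<in>A. h k))"
proof -
  let ?e = "emp_freq n X"
  have e0: "0 \<le> ?e k" for k by (rule emp_freq_nonneg)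
  have e1: "(\<Sum>k\<in>A. ?e k) = 1" 
  proof -
    have "(\<Sum>k\<in>A. ?e k * 1) = (\<Sum>i<n. 1) / real n" using A XA by (rule sum_emp_freq)
    then show ?thesis using n by simp
  qed
  have hp: "0 < (\<Prod>i<n. h (X i))" by (rule prod_pos) (use hX in auto)
  have h'X: "0 < h' (X i)" if "i < n" for i
  proof (rule ccontr)
    assume "\<not> 0 < h' (X i)"
    then have "h' (X i) = 0" using h'0[of "X i"] by simp
    then have "(\<Prod>i<n. h' (X i)) = 0" using that by auto
    then show False using like hp by linarith
  qed
  have "ln (\<Prod>i<n. h (X i)) \<le> ln (\<Prod>i<n. h' (X i))" using like hp by simp
  then have "(\<Sum>i<n. ln (h (X i))) \<le> (\<Sum>i<n. ln (h' (X i)))"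
    by (subst (asm) (1 2) ln_prod) (use hX h'X in \<open>auto simp: less_imp_neq[symmetric]\<close>)
  then have "0 \<le> (\<Sum>i<n. ln (h' (X i)) - ln (h (X i))) / real n"
    by (simp add: sum_subtractf)
  also have "\<dots> = (\<Sum>k\<in>A. ?e k * (ln (h' k) - ln (h k)))"
    by (subst sum_emp_freq[OF A XA]) auto
  also have "\<dots> \<le> (\<Sum>k\<in>A. 2 * (sqrt (?e k) * sqrt (h' k)) - 2 * ?e k + (?e k)\<^sup>2 / h k - ?e k)"
  proof (rule sum_mono)
    fix k
    show "?e k * (ln (h' k) - ln (h k)) \<le> 2 * (sqrt (?e k) * sqrt (h' k)) - 2 * ?e k + (?e k)\<^sup>2 / h k - ?e k"
    proof (cases "?e k = 0")
      case False
      then obtain i where i: "i < n" "X i = k" by (rule emp_freq_pos_imp)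
      have p: "0 < h k" "0 < h' k" "0 < ?e k" using hX[OF i(1)] h'X[OF i(1)] i(2) False e0[of k] by auto
      \<comment> \<open>Taking the root before ln x <= x - 1 produces the Hellinger affinity sqrt (e
        h') instead of h' itself.\<close>
      have "ln (sqrt (h' k / ?e k)) \<le> sqrt (h' k / ?e k) - 1" by (rule ln_le_minus_one) (use p in simp)
      then have 1: "ln (h' k) - ln (?e k) \<le> 2 * (sqrt (h' k) / sqrt (?e k)) - 2"
        using p by (simp add: ln_sqrt ln_div real_sqrt_divide)
      have "ln (?e k / h k) \<le> ?e k / h k - 1" by (rule ln_le_minus_one) (use p in simp)
      then have 2: "ln (?e k) - ln (h k) \<le> ?e k / h k - 1" using p by (simp add: ln_div)
      have "?e k * (ln (h' k) - ln (h k)) \<le> ?e k * (2 * (sqrt (h' k) / sqrt (?e k)) - 2 + ?e k / h k - 1)"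
        using 1 2 p by (intro mult_left_mono) auto
      also have "\<dots> = 2 * (?e k / sqrt (?e k) * sqrt (h' k)) - 2 * ?e k + (?e k)\<^sup>2 / h k - ?e k"
        by (simp add: algebra_simps power2_eq_square)
      also have "?e k / sqrt (?e k) = sqrt (?e k)" using p by (simp add: real_div_sqrt)
      finally show ?thesis .
    qed simp
  qed
  also have "\<dots> = 2 * (\<Sum>k\<in>A. sqrt (?e k) * sqrt (h' k)) - 3 + (\<Sum>k\<in>A. (?e k)\<^sup>2 / h k)"
    by (simp add: sum.distrib sum_subtractf sum_distrib_left[symmetric] e1)
  finally have kl: "0 \<le> 2 * (\<Sum>k\<in>A. sqrt (?e k) * sqrt (h' k)) - 3 + (\<Sum>k\<in>A. (?e k)\<^sup>2 / h k)" .
  have "(\<Sum>k\<in>A. (sqrt (?e k) - sqrt (h' k))\<^sup>2) = (\<Sum>k\<in>A. ?e k + h' k - 2 * (sqrt (?e k) * sqrt (h' k)))"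
    using e0 h'0 by (intro sum.cong) (auto simp: power2_diff)
  also have "\<dots> = 1 + (\<Sum>k\<in>A. h' k) - 2 * (\<Sum>k\<in>A. sqrt (?e k) * sqrt (h' k))"
    by (simp add: sum.distrib sum_subtractf sum_distrib_left[symmetric] e1)
  also have "\<dots> \<le> (\<Sum>k\<in>A. (?e k)\<^sup>2 / h k) - 1" using kl sum' by simp
  \<comment> \<open>Per cell, (e - h)^2 / h = e^2 / h - 2 e + h. The frequencies sum to 1 over
    \<open>A\<close> but \<open>h\<close> need not, hence the extra missing mass 1 - sum h.\<close>
  also have "\<dots> = chi2_stat A h n X + (1 - (\<Sum>k\<in>A. h k))"
  proof -
    have "(?e k - h k)\<^sup>2 / h k = (?e k)\<^sup>2 / h k - 2 * ?e k + h k" for k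
    proof (cases "h k = 0")
      case True
      then have "?e k = 0" using hX emp_freq_pos_imp by (metis less_irrefl)
      with True show ?thesis by simp
    qed (simp add: field_simps power2_eq_square)
    then show ?thesis
      unfolding chi2_stat_def by (simp add: sum.distrib sum_subtractf sum_distrib_left[symmetric] e1)
  qed
  finally show ?thesis .
qed

text \<open>Per cell, multiplying by h <= (sqrt e + sqrt h)^2 turns the squared difference of roots
  into (e - h)^2.\<close>

lemma hellinger_emp_le_chi2:
  fixes h :: "nat \<Rightarrow> real"
  assumes hX: "\<And>i. i < n \<Longrightarrow> 0 < h (X i)" and h0: "\<And>k. 0 \<le> h k"
  shows "(\<Sum>k\<in>A. (sqrt (h k) - sqrt (emp_freq n X k))\<^sup>2) \<le> chi2_stat A h n X"
  unfolding chi2_stat_def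
proof (rule sum_mono)
  fix k
  let ?e = "emp_freq n X k"
  show "(sqrt (h k) - sqrt ?e)\<^sup>2 \<le> (?e - h k)\<^sup>2 / h k"
  proof (cases "h k = 0")
    case True
    then have "?e = 0" using hX emp_freq_pos_imp by (metis less_irrefl)
    with True show ?thesis by simp
  next
    case False
    then have p: "0 < h k" using h0[of k] by simp
    have e: "0 \<le> ?e" by (rule emp_freq_nonneg)
    have "(sqrt (h k) - sqrt ?e)\<^sup>2 * h k \<le> (sqrt (h k) - sqrt ?e)\<^sup>2 * (sqrt ?e + sqrt (h k))\<^sup>2"
    proof (rule mult_left_mono)
      have "(sqrt (h k))\<^sup>2 \<le> (sqrt ?e + sqrt (h k))\<^sup>2" using p e by (intro power_mono) auto
      then show "h k \<le> (sqrt ?e + sqrt (h k))\<^sup>2" using p by simp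
    qed simp
    also have "\<dots> = ((sqrt (h k))\<^sup>2 - (sqrt ?e)\<^sup>2)\<^sup>2"
      by (simp only: power_mult_distrib[symmetric]) (simp add: algebra_simps power2_eq_square)
    also have "\<dots> = (?e - h k)\<^sup>2" using p e by (simp add: power2_commute)
    finally show ?thesis using p by (simp add: pos_le_divide_eq)
  qed
qed

text \<open>The empirical frequencies serve as the intermediate point, with (a - c)^2 <= 2 (a - b)^2
  + 2 (b - c)^2. Each half contributes 2 to the coefficient 4; the missing mass enters only through
  the maximiser.\<close>

lemma hellinger_mle_le_chi2:
  fixes h h' :: "nat \<Rightarrow> real"
  assumes A: "finite A" and XA: "\<And>i. i < n \<Longrightarrow> X i \<in> A" and hX: "\<And>i. i < n \<Longrightarrow> 0 < h (X i)"
    and n: "0 < n" and h0: "\<And>k. 0 \<le> h k" and h'0: "\<And>k. 0 \<le> h' k"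
    and sum': "(\<Sum>k\<in>A. h' k) \<le> 1"
    and like: "(\<Prod>i<n. h (X i)) \<le> (\<Prod>i<n. h' (X i))"
  shows "(\<Sum>k\<in>A. (sqrt (h k) - sqrt (h' k))\<^sup>2) \<le> 4 * chi2_stat A h n X + 2 * (1 - (\<Sum>k\<in>A. h k))"
proof -
  let ?e = "emp_freq n X"
  have "(\<Sum>k\<in>A. (sqrt (h k) - sqrt (h' k))\<^sup>2)
    \<le> (\<Sum>k\<in>A. 2 * (sqrt (h k) - sqrt (?e k))\<^sup>2 + 2 * (sqrt (?e k) - sqrt (h' k))\<^sup>2)"
  proof (rule sum_mono)
    fix k
    have "(a - c)\<^sup>2 \<le> 2 * (a - b)\<^sup>2 + 2 * (b - c)\<^sup>2" for a b c :: real
      using zero_le_power2[of "a - 2 * b + c"] by (simp add: power2_eq_square algebra_simps)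
    then show "(sqrt (h k) - sqrt (h' k))\<^sup>2 \<le> 2 * (sqrt (h k) - sqrt (?e k))\<^sup>2 + 2 * (sqrt (?e k) - sqrt (h' k))\<^sup>2" .
  qed
  also have "\<dots> = 2 * (\<Sum>k\<in>A. (sqrt (h k) - sqrt (?e k))\<^sup>2) + 2 * (\<Sum>k\<in>A. (sqrt (?e k) - sqrt (h' k))\<^sup>2)"
    by (simp add: sum.distrib sum_distrib_left)
  also have "\<dots> \<le> 4 * chi2_stat A h n X + 2 * (1 - (\<Sum>k\<in>A. h k))"
  proof -
    have "(\<Sum>k\<in>A. (sqrt (h k) - sqrt (?e k))\<^sup>2) \<le> chi2_stat A h n X"
      using hX h0 by (rule hellinger_emp_le_chi2)
    moreover have "(\<Sum>k\<in>A. (sqrt (?e k) - sqrt (h' k))\<^sup>2) \<le> chi2_stat A h n X + (1 - (\<Sum>k\<in>A. h k))"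
      using A XA hX n h0 h'0 sum' like by (rule hellinger_le_chi2_of_likelihood)
    moreover have "2 * a + 2 * b \<le> 4 * c + 2 * (1 - s)" if "a \<le> c" "b \<le> c + (1 - s)" for a b c s :: real
      using that by simp
    ultimately show ?thesis by blast
  qed
  finally show ?thesis .
qed

text \<open>Cauchy-Schwarz for h - h' = (sqrt h + sqrt h') (sqrt h - sqrt h'). The common majorant
  \<open>m\<close> bounds the first factor for both functions. The free parameter \<open>l\<close>
  makes the result linear in the squared Hellinger distance, so that expectations can be taken
  directly.\<close>

lemma weighted_l1_le_hellinger:
  fixes h h' b m :: "nat \<Rightarrow> real"
  assumes A: "finite A" and h0: "\<And>k. 0 \<le> h k" and h'0: "\<And>k. 0 \<le> h' k" and b0: "\<And>k. 0 \<le> b k"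
    and m: "\<And>k. (b k)\<^sup>2 * h k \<le> m k" and m': "\<And>k. (b k)\<^sup>2 * h' k \<le> m k" and L: "0 < l"
  shows "(\<Sum>k\<in>A. b k * \<bar>h k - h' k\<bar>)
    \<le> sqrt (\<Sum>k\<in>A. m k) * (l * (\<Sum>k\<in>A. (sqrt (h k) - sqrt (h' k))\<^sup>2) + 1 / l)"
proof -
  let ?D = "\<Sum>k\<in>A. (sqrt (h k) - sqrt (h' k))\<^sup>2" and ?M = "\<Sum>k\<in>A. m k"
  have m0: "0 \<le> m k" for k using m[of k] h0[of k] by (meson mult_nonneg_nonneg order_trans zero_le_power2)
  have M0: "0 \<le> ?M" and D0: "0 \<le> ?D" using m0 by (auto intro: sum_nonneg)
  have "(\<Sum>k\<in>A. b k * \<bar>h k - h' k\<bar>) = (\<Sum>k\<in>A. (b k * (sqrt (h k) + sqrt (h' k))) * \<bar>sqrt (h k) - sqrt (h' k)\<bar>)"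
  proof (rule sum.cong)
    fix k
    have "h k - h' k = (sqrt (h k) + sqrt (h' k)) * (sqrt (h k) - sqrt (h' k))"
      using h0[of k] h'0[of k] by (simp add: algebra_simps)
    then have "\<bar>h k - h' k\<bar> = (sqrt (h k) + sqrt (h' k)) * \<bar>sqrt (h k) - sqrt (h' k)\<bar>"
      using h0[of k] h'0[of k] by (simp add: abs_mult)
    then show "b k * \<bar>h k - h' k\<bar> = (b k * (sqrt (h k) + sqrt (h' k))) * \<bar>sqrt (h k) - sqrt (h' k)\<bar>" by simp
  qed simp
  also have "\<dots> \<le> sqrt (4 * ?M * ?D)"
  proof (rule real_le_rsqrt)
    have "(\<Sum>k\<in>A. (b k * (sqrt (h k) + sqrt (h' k))) * \<bar>sqrt (h k) - sqrt (h' k)\<bar>)\<^sup>2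
      \<le> (\<Sum>k\<in>A. (b k * (sqrt (h k) + sqrt (h' k)))\<^sup>2) * (\<Sum>k\<in>A. \<bar>sqrt (h k) - sqrt (h' k)\<bar>\<^sup>2)"
      by (rule Cauchy_Schwarz_ineq_sum)
    also have "\<dots> \<le> (4 * ?M) * ?D"
    proof (rule mult_mono)
      show "(\<Sum>k\<in>A. (b k * (sqrt (h k) + sqrt (h' k)))\<^sup>2) \<le> 4 * ?M"
        unfolding sum_distrib_left
      proof (rule sum_mono)
        fix k
        have "(x + y)\<^sup>2 \<le> 2 * x\<^sup>2 + 2 * y\<^sup>2" for x y :: real
          using zero_le_power2[of "x - y"] by (simp add: power2_eq_square algebra_simps)
        from this[of "sqrt (h k)" "sqrt (h' k)"]
        have "(sqrt (h k) + sqrt (h' k))\<^sup>2 \<le> 2 * h k + 2 * h' k" using h0[of k] h'0[of k] by simp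
        then have "(b k)\<^sup>2 * (sqrt (h k) + sqrt (h' k))\<^sup>2 \<le> (b k)\<^sup>2 * (2 * h k + 2 * h' k)"
          by (rule mult_left_mono) simp
        also have "\<dots> \<le> 4 * m k" using m[of k] m'[of k] by (simp add: algebra_simps)
        finally show "(b k * (sqrt (h k) + sqrt (h' k)))\<^sup>2 \<le> 4 * m k" by (simp only: power_mult_distrib)
      qed
    qed (use M0 D0 in \<open>auto intro: sum_nonneg\<close>)
    finally show "(\<Sum>k\<in>A. (b k * (sqrt (h k) + sqrt (h' k))) * \<bar>sqrt (h k) - sqrt (h' k)\<bar>)\<^sup>2 \<le> 4 * ?M * ?D" .
  qed
  also have "\<dots> = sqrt ?M * (2 * sqrt ?D)" by (simp add: real_sqrt_mult)
  also have "\<dots> \<le> sqrt ?M * (l * ?D + 1 / l)"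
  proof (rule mult_left_mono)
    have "0 \<le> (l * sqrt ?D - 1)\<^sup>2 / l" using L by simp
    also have "\<dots> = l * (sqrt ?D)\<^sup>2 + 1 / l - 2 * sqrt ?D"
      using L by (simp add: field_simps power2_eq_square)
    finally show "2 * sqrt ?D \<le> l * ?D + 1 / l" using D0 by simp
  qed (use M0 in simp)
  finally show ?thesis .
qed

section \<open>Sampling from a Poisson mixture\<close>

lemma suminf_ennreal_pois_mix:
  assumes Q: "Q \<in> prob_on t"
  shows "(\<Sum>k. ennreal (pois_mix Q k)) = 1"
proof -
  interpret prob_space Q using Q by (simp add: prob_on_def)
  have [measurable_cong]: "sets Q = sets borel" using Q by (auto simp: prob_on_def)
  have "(\<Sum>k. ennreal (pois_mix Q k)) = (\<Sum>k. \<integral>\<^sup>+\<theta>. ennreal (exp (- \<theta>) * \<theta> ^ k / fact k) \<partial>Q)"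
    unfolding pois_mix_def
    by (intro arg_cong[where f = suminf] ext nn_integral_eq_integral[symmetric] pois_kernel_integrable[OF Q])
       (use prob_on_AE[OF Q] in \<open>eventually_elim, simp\<close>)
  also have "\<dots> = (\<integral>\<^sup>+\<theta>. (\<Sum>k. ennreal (exp (- \<theta>) * \<theta> ^ k / fact k)) \<partial>Q)"
    by (rule nn_integral_suminf[symmetric]) measurable
  also have "\<dots> = (\<integral>\<^sup>+\<theta>. 1 \<partial>Q)"
  proof (rule nn_integral_cong_AE)
    show "AE \<theta> in Q. (\<Sum>k. ennreal (exp (- \<theta>) * \<theta> ^ k / fact k)) = 1"
      using prob_on_AE[OF Q]
    proof eventually_elim
      case (elim \<theta>)
      have "(\<lambda>k. exp (- \<theta>) * (\<theta> ^ k /\<^sub>R fact k)) sums (exp (- \<theta>) * exp \<theta>)"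
        by (intro sums_mult exp_converges)
      also have "(\<lambda>k. exp (- \<theta>) * (\<theta> ^ k /\<^sub>R fact k)) = (\<lambda>k. exp (- \<theta>) * \<theta> ^ k / fact k)"
        by (simp add: divide_inverse mult_ac)
      also have "exp (- \<theta>) * exp \<theta> = 1" by (simp add: exp_minus)
      finally have s: "(\<lambda>k. exp (- \<theta>) * \<theta> ^ k / fact k) sums 1" .
      have nn: "0 \<le> exp (- \<theta>) * \<theta> ^ k / fact k" for k using elim by simp
      from suminf_ennreal_eq[OF nn s] show ?case by simp
    qed
  qed
  also have "\<dots> = 1" by (simp add: emeasure_space_1)
  finally show ?thesis .
qed

lemma pois_mix_sums:
  assumes Q: "Q \<in> prob_on t"
  shows "pois_mix Q sums 1"
proof -
  have s: "summable (pois_mix Q)"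
    by (rule summable_suminf_not_top) (use pois_mix_nonneg[OF Q] suminf_ennreal_pois_mix[OF Q] in auto)
  have "ennreal (suminf (pois_mix Q)) = 1"
    using suminf_ennreal2[OF pois_mix_nonneg[OF Q] s] suminf_ennreal_pois_mix[OF Q] by simp
  then have "suminf (pois_mix Q) = 1" by simp
  with s show ?thesis by (simp add: sums_iff)
qed

lemma prob_space_pois_mix_measure:
  assumes Q: "Q \<in> prob_on t"
  shows "prob_space (pois_mix_measure Q)"
proof (rule prob_spaceI)
  show "emeasure (pois_mix_measure Q) (space (pois_mix_measure Q)) = 1"
    unfolding pois_mix_measure_def
    by (simp add: emeasure_density nn_integral_count_space_nat suminf_ennreal_pois_mix[OF Q])
qed

lemma sets_pois_mix_measure [simp]: "sets (pois_mix_measure Q) = UNIV"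
  and space_pois_mix_measure [simp]: "space (pois_mix_measure Q) = UNIV"
  by (simp_all add: pois_mix_measure_def)

lemma measurable_pois_mix_measure [simp, intro]: "f \<in> borel_measurable (pois_mix_measure Q)"
  by (simp add: measurable_def)

text \<open>The product over the coordinates isolates the coordinates \<open>i\<close> and \<open>j\<close>; it also covers \<open>i = j\<close>.\<close>
lemma PiM_integral_pair:
  fixes g1 g2 :: "'a \<Rightarrow> real" and i j n :: nat
  assumes P: "prob_space P" and i: "i < n" and j: "j < n"
    and bdd: "\<And>x. \<bar>g1 x\<bar> \<le> B" "\<And>x. \<bar>g2 x\<bar> \<le> B"
    and m [measurable]: "g1 \<in> borel_measurable P" "g2 \<in> borel_measurable P"
  shows "(\<integral>X. g1 (X i) * g2 (X j) \<partial>PiM {..<n} (\<lambda>_. P))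
    = (if i = j then \<integral>x. g1 x * g2 x \<partial>P else (\<integral>x. g1 x \<partial>P) * (\<integral>x. g2 x \<partial>P))"
    and "integrable (PiM {..<n} (\<lambda>_. P)) (\<lambda>X. g1 (X i) * g2 (X j))"
proof -
  interpret P: prob_space P by fact
  interpret PP: product_prob_space "\<lambda>_. P" "{..<n}" ..
  define f where "f l x = (if l = i then g1 x else 1) * (if l = j then g2 x else 1)" for l x
  have int1: "integrable P g1" "integrable P g2" using bdd by (auto intro!: P.integrable_const_bound[where B = B])
  have int2: "integrable P (\<lambda>x. g1 x * g2 x)"
  proof (rule P.integrable_const_bound[where B = "B * B"])
    show "AE x in P. norm (g1 x * g2 x) \<le> B * B"
      using bdd by (intro AE_I2) (auto simp: abs_mult intro!: mult_mono order_trans[OF abs_ge_zero bdd(1)])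
  qed measurable
  have int: "integrable P (f l)" for l
    unfolding f_def using int1 int2 by (cases "l = i"; cases "l = j") auto
  have prod: "(\<Prod>l<n. f l (X l)) = g1 (X i) * g2 (X j)" for X
    unfolding f_def prod.distrib using i j by (simp add: prod.delta)
  show "integrable (PiM {..<n} (\<lambda>_. P)) (\<lambda>X. g1 (X i) * g2 (X j))"
    unfolding prod[symmetric] by (rule PP.product_integrable_prod) (use int in auto)
  have "(\<integral>X. g1 (X i) * g2 (X j) \<partial>PiM {..<n} (\<lambda>_. P)) = (\<Prod>l<n. \<integral>x. f l x \<partial>P)"
    unfolding prod[symmetric] by (rule PP.product_integral_prod) (use int in auto)
  also have "\<dots> = (if i = j then \<integral>x. g1 x * g2 x \<partial>P else (\<integral>x. g1 x \<partial>P) * (\<integral>x. g2 x \<partial>P))"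
  proof (cases "i = j")
    case True
    have "(\<integral>x. f l x \<partial>P) = (if l = i then \<integral>x. g1 x * g2 x \<partial>P else 1)" for l
      unfolding f_def using True by (simp add: P.prob_space)
    then show ?thesis using i True by (simp add: prod.delta)
  next
    case False
    have "(\<integral>x. f l x \<partial>P) = (if l = i then \<integral>x. g1 x \<partial>P else 1) * (if l = j then \<integral>x. g2 x \<partial>P else 1)" for l
      unfolding f_def using False by (simp add: P.prob_space)
    then show ?thesis using i j False by (simp add: prod.delta prod.distrib)
  qed
  finally show "(\<integral>X. g1 (X i) * g2 (X j) \<partial>PiM {..<n} (\<lambda>_. P))
    = (if i = j then \<integral>x. g1 x * g2 x \<partial>P else (\<integral>x. g1 x \<partial>P) * (\<integral>x. g2 x \<partial>P))" .
qed

text \<open>Centred coordinates are uncorrelated, so only the n diagonal terms survive, and the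
  variance of \<open>f\<close> is at most E f^2 <= E f because 0 <= f <= 1. Keeping \<open>p\<close>
  in the bound is what cancels the denominator of the chi-square statistic.\<close>

lemma PiM_variance_mean:
  fixes f :: "'a \<Rightarrow> real"
  assumes P: "prob_space P" and n: "0 < n" and bdd: "\<And>x. 0 \<le> f x" "\<And>x. f x \<le> 1"
    and m [measurable]: "f \<in> borel_measurable P"
    and p: "p = (\<integral>x. f x \<partial>P)"
  shows "(\<integral>X. ((\<Sum>i<n. f (X i)) / real n - p)\<^sup>2 \<partial>PiM {..<n} (\<lambda>_. P)) \<le> p / real n"
    and "integrable (PiM {..<n} (\<lambda>_. P)) (\<lambda>X. ((\<Sum>i<n. f (X i)) / real n - p)\<^sup>2)"
proof -
  interpret P: prob_space P by fact
  let ?M = "PiM {..<n} (\<lambda>_. P)"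
  let ?g = "\<lambda>x. f x - p"
  have int: "integrable P f" by (rule P.integrable_const_bound[where B = 1]) (use bdd in auto)
  have int2: "integrable P (\<lambda>x. (f x)\<^sup>2)"
    by (rule P.integrable_const_bound[where B = 1]) (use bdd in \<open>auto simp: power_le_one\<close>)
  have p01: "0 \<le> p" unfolding p using bdd by (intro Bochner_Integration.integral_nonneg) auto
  have g0: "(\<integral>x. ?g x \<partial>P) = 0" using int by (simp add: P.prob_space p)
  have g2: "(\<integral>x. ?g x * ?g x \<partial>P) \<le> p"
  proof -
    have "(\<integral>x. ?g x * ?g x \<partial>P) = (\<integral>x. (f x)\<^sup>2 - 2 * p * f x + p\<^sup>2 \<partial>P)"
      by (rule Bochner_Integration.integral_cong) (auto simp: power2_eq_square algebra_simps)
    also have "\<dots> = (\<integral>x. (f x)\<^sup>2 \<partial>P) - p\<^sup>2"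
      using int int2 by (simp add: P.prob_space p[symmetric] power2_eq_square)
    also have "\<dots> \<le> (\<integral>x. f x \<partial>P)"
    proof -
      have "(\<integral>x. (f x)\<^sup>2 \<partial>P) \<le> (\<integral>x. f x \<partial>P)"
        using int int2 bdd by (intro integral_mono) (auto simp: power2_eq_square intro: mult_left_le)
      then show ?thesis by (smt (verit) zero_le_power2)
    qed
    finally show ?thesis by (simp add: p)
  qed
  have gb: "\<bar>?g x\<bar> \<le> 1 + p" for x using bdd[of x] p01 by linarith
  have gm: "?g \<in> borel_measurable P" by measurable
  have sq: "((\<Sum>i<n. f (X i)) / real n - p)\<^sup>2 = (\<Sum>i<n. \<Sum>j<n. ?g (X i) * ?g (X j)) / (real n)\<^sup>2" for X :: "nat \<Rightarrow> 'a"
  proof -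
    have "(\<Sum>i<n. f (X i)) / real n - p = (\<Sum>i<n. ?g (X i)) / real n"
      using n by (simp add: sum_subtractf field_simps)
    then show ?thesis by (simp add: power_divide power2_eq_square[of "sum _ _"] sum_product)
  qed
  have pair: "integrable ?M (\<lambda>X. ?g (X i) * ?g (X j))"
    "(\<integral>X. ?g (X i) * ?g (X j) \<partial>?M) = (if i = j then \<integral>x. ?g x * ?g x \<partial>P else 0)" if "i < n" "j < n" for i j
    using PiM_integral_pair[OF P that gb gb gm gm] g0 by auto
  show "integrable ?M (\<lambda>X. ((\<Sum>i<n. f (X i)) / real n - p)\<^sup>2)"
    unfolding sq using pair(1) by (intro Bochner_Integration.integrable_divide Bochner_Integration.integrable_sum) auto
  have "(\<integral>X. ((\<Sum>i<n. f (X i)) / real n - p)\<^sup>2 \<partial>?M) = (\<Sum>i<n. \<Sum>j<n. \<integral>X. ?g (X i) * ?g (X j) \<partial>?M) / (real n)\<^sup>2"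
  proof -
    have "(\<integral>X. (\<Sum>i<n. \<Sum>j<n. ?g (X i) * ?g (X j)) \<partial>?M) = (\<Sum>i<n. \<integral>X. (\<Sum>j<n. ?g (X i) * ?g (X j)) \<partial>?M)"
      by (rule Bochner_Integration.integral_sum) (intro Bochner_Integration.integrable_sum pair(1), simp_all)
    also have "\<dots> = (\<Sum>i<n. \<Sum>j<n. \<integral>X. ?g (X i) * ?g (X j) \<partial>?M)"
      by (intro sum.cong refl Bochner_Integration.integral_sum pair(1)) auto
    finally show ?thesis unfolding sq integral_divide_zero by simp
  qed
  also have "\<dots> = (\<Sum>i<n. \<Sum>j<n. if i = j then \<integral>x. ?g x * ?g x \<partial>P else 0) / (real n)\<^sup>2"
    using pair(2) by simp
  also have "\<dots> = real n * (\<integral>x. ?g x * ?g x \<partial>P) / (real n)\<^sup>2"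
    by simp
  also have "\<dots> \<le> real n * p / (real n)\<^sup>2"
    using g2 by (intro divide_right_mono mult_left_mono) auto
  also have "\<dots> = p / real n" using n by (simp add: power2_eq_square)
  finally show "(\<integral>X. ((\<Sum>i<n. f (X i)) / real n - p)\<^sup>2 \<partial>?M) \<le> p / real n" .
qed

lemma integral_pois_mix_measure_indicator:
  assumes Q: "Q \<in> prob_on t"
  shows "(\<integral>x. (if x = k then 1 else 0) \<partial>pois_mix_measure Q) = pois_mix Q k"
proof -
  interpret P: prob_space "pois_mix_measure Q" by (rule prob_space_pois_mix_measure[OF Q])
  have "(\<integral>x. (if x = k then 1 else 0 :: real) \<partial>pois_mix_measure Q) = (\<integral>x. indicator {k} x \<partial>pois_mix_measure Q)"
    by (rule Bochner_Integration.integral_cong) (auto simp: indicator_def)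
  also have "\<dots> = P.prob {k}" by simp
  also have "emeasure (pois_mix_measure Q) {k} = ennreal (pois_mix Q k)"
    unfolding pois_mix_measure_def by (simp add: emeasure_density nn_integral_count_space_indicator[symmetric])
  then have "P.prob {k} = pois_mix Q k" using pois_mix_nonneg[OF Q, of k] by (simp add: measure_def)
  finally show ?thesis .
qed

text \<open>The frequency of cell k has variance at most h(k)/n, so after division by h(k) every
  cell contributes at most 1/n, however small its mass.\<close>

lemma expectation_chi2_stat:
  assumes Q: "Q \<in> prob_on t" and n: "0 < n" and A: "finite A"
  shows "integrable (sample_law Q n) (chi2_stat A (pois_mix Q) n)"
    and "(\<integral>X. chi2_stat A (pois_mix Q) n X \<partial>sample_law Q n) \<le> real (card A) / real n"
proof -
  let ?f = "\<lambda>k x. if x = k then 1 else 0 :: real"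
  note P = prob_space_pois_mix_measure[OF Q]
  have e: "emp_freq n X k = (\<Sum>i<n. ?f k (X i)) / real n" for X k by (simp add: emp_freq_def)
  have v: "integrable (sample_law Q n) (\<lambda>X. (emp_freq n X k - pois_mix Q k)\<^sup>2)"
    "(\<integral>X. (emp_freq n X k - pois_mix Q k)\<^sup>2 \<partial>sample_law Q n) \<le> pois_mix Q k / real n" for k
    unfolding e sample_law_def
    using PiM_variance_mean[OF P n, of "?f k" "pois_mix Q k"] integral_pois_mix_measure_indicator[OF Q, of k] by auto
  show "integrable (sample_law Q n) (chi2_stat A (pois_mix Q) n)"
    unfolding chi2_stat_def by (intro Bochner_Integration.integrable_sum Bochner_Integration.integrable_divide v)
  have "(\<integral>X. chi2_stat A (pois_mix Q) n X \<partial>sample_law Q n)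
      = (\<Sum>k\<in>A. (\<integral>X. (emp_freq n X k - pois_mix Q k)\<^sup>2 \<partial>sample_law Q n) / pois_mix Q k)"
    unfolding chi2_stat_def using v(1) by (simp add: Bochner_Integration.integral_sum)
  also have "\<dots> \<le> (\<Sum>k\<in>A. 1 / real n)"
  proof (rule sum_mono)
    fix k
    have "(\<integral>X. (emp_freq n X k - pois_mix Q k)\<^sup>2 \<partial>sample_law Q n) / pois_mix Q k \<le> (pois_mix Q k / real n) / pois_mix Q k"
      by (intro divide_right_mono v pois_mix_nonneg[OF Q])
    also have "\<dots> \<le> 1 / real n" by simp
    finally show "(\<integral>X. (emp_freq n X k - pois_mix Q k)\<^sup>2 \<partial>sample_law Q n) / pois_mix Q k \<le> 1 / real n" .
  qed
  also have "\<dots> = real (card A) / real n" by simp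
  finally show "(\<integral>X. chi2_stat A (pois_mix Q) n X \<partial>sample_law Q n) \<le> real (card A) / real n" .
qed

text \<open>Points of \<open>A\<close> with zero mass count as missed, so that the likelihood of \<open>Q\<close> is positive
  on samples without misses.\<close>
definition misses :: "nat set \<Rightarrow> (nat \<Rightarrow> real) \<Rightarrow> nat \<Rightarrow> (nat \<Rightarrow> nat) \<Rightarrow> real" where
  "misses A h n X = (\<Sum>i<n. if X i \<in> A \<and> 0 < h (X i) then 0 else 1)"

text \<open>\<open>misses\<close> is at least 1 on every bad sample, so its mean acts as a union
  bound. Points of zero mass do not change the mean.\<close>

lemma expectation_misses:
  assumes Q: "Q \<in> prob_on t" and A: "finite A"
  shows "integrable (sample_law Q n) (misses A (pois_mix Q) n)"
    and "(\<integral>X. misses A (pois_mix Q) n X \<partial>sample_law Q n) = real n * (1 - (\<Sum>k\<in>A. pois_mix Q k))"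
proof -
  let ?P = "pois_mix_measure Q" and ?h = "pois_mix Q"
  interpret P: prob_space ?P by (rule prob_space_pois_mix_measure[OF Q])
  let ?g = "\<lambda>x. if x \<in> A \<and> 0 < ?h x then 0 else 1 :: real"
  have g: "integrable (sample_law Q n) (\<lambda>X. ?g (X i))" "(\<integral>X. ?g (X i) \<partial>sample_law Q n) = (\<integral>x. ?g x \<partial>?P)" if i: "i < n" for i
    using PiM_integral_pair[OF P.prob_space_axioms i i, of ?g 1 "\<lambda>_. 1"] by (auto simp: sample_law_def)
  have "(\<integral>x. ?g x \<partial>?P) = (\<integral>x. 1 - (\<Sum>k\<in>A. (if 0 < ?h k then 1 else 0) * (if x = k then 1 else 0)) \<partial>?P)"
  proof (intro Bochner_Integration.integral_cong refl)
    fix x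
    have "(\<Sum>k\<in>A. (if 0 < ?h k then 1 else 0) * (if x = k then 1 else 0 :: real))
        = (\<Sum>k\<in>A. if k = x then (if 0 < ?h k then 1 else 0) else 0)"
      by (intro sum.cong) auto
    also have "\<dots> = (if x \<in> A then if 0 < ?h x then 1 else 0 else 0)"
      using A by (rule sum.delta)
    finally show "?g x = 1 - (\<Sum>k\<in>A. (if 0 < ?h k then 1 else 0) * (if x = k then 1 else 0))"
      by simp
  qed
  also have "\<dots> = 1 - (\<Sum>k\<in>A. (if 0 < ?h k then 1 else 0) * ?h k)"
  proof -
    have "integrable ?P (\<lambda>x. if x = k then 1 else 0 :: real)" for k
      by (rule P.integrable_const_bound[where B = 1]) auto
    then show ?thesis
      using P.prob_space by (subst Bochner_Integration.integral_diff)
         (auto simp: Bochner_Integration.integral_sum integral_pois_mix_measure_indicator[OF Q])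
  qed
  also have "(\<Sum>k\<in>A. (if 0 < ?h k then 1 else 0) * ?h k) = (\<Sum>k\<in>A. ?h k)"
    using pois_mix_nonneg[OF Q] by (intro sum.cong) (auto simp: not_less intro: antisym)
  finally have eg: "(\<integral>x. ?g x \<partial>?P) = 1 - (\<Sum>k\<in>A. ?h k)" .
  show "integrable (sample_law Q n) (misses A ?h n)"
    unfolding misses_def using g(1) by (intro Bochner_Integration.integrable_sum) auto
  show "(\<integral>X. misses A ?h n X \<partial>sample_law Q n) = real n * (1 - (\<Sum>k\<in>A. ?h k))"
    unfolding misses_def using g by (simp add: Bochner_Integration.integral_sum eg)
qed

section \<open>The risk of the estimator\<close>

text \<open>A single term of the exponential series. With x = k it is the weak Stirling bound; with
  x fixed it gives summability.\<close>

lemma power_div_fact_le_exp: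
  fixes x :: real
  assumes "0 \<le> x"
  shows "x ^ k / fact k \<le> exp x"
proof -
  have s: "(\<lambda>k. x ^ k / fact k) sums exp x"
    using exp_converges[of x] by (simp add: divide_inverse mult.commute)
  have "(\<Sum>i\<in>{k}. x ^ i / fact i) \<le> (\<Sum>i. x ^ i / fact i)"
    by (rule sum_le_suminf) (use s assms in \<open>auto simp: sums_iff\<close>)
  with s show ?thesis by (simp add: sums_iff)
qed

text \<open>Applied to (2 a)^2, the preceding bound shows that (2 a)^k / sqrt (k!) is bounded; the
  spare factor 2^k gives geometric decay.\<close>

lemma summable_power_div_sqrt_fact:
  fixes a :: real
  assumes "0 \<le> a"
  shows "summable (\<lambda>k. a ^ k / sqrt (fact k))"
proof (rule summable_comparison_test[OF _ summable_mult[OF summable_geometric]], intro exI allI impI)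
  fix k :: nat
  have "(2 * a)\<^sup>2 ^ k / fact k \<le> exp ((2 * a)\<^sup>2)" by (rule power_div_fact_le_exp) simp
  then have "sqrt ((2 * a)\<^sup>2 ^ k / fact k) \<le> sqrt (exp ((2 * a)\<^sup>2))" by simp
  also have "sqrt ((2 * a)\<^sup>2 ^ k / fact k) = (2 * a) ^ k / sqrt (fact k)"
  proof -
    have "sqrt ((2 * a)\<^sup>2) = 2 * a" by (rule real_sqrt_unique) (use assms in auto)
    then show ?thesis unfolding real_sqrt_divide real_sqrt_power[of _ k] by simp
  qed
  finally have "2 ^ k * (a ^ k / sqrt (fact k)) \<le> sqrt (exp ((2 * a)\<^sup>2))"
    by (simp only: power_mult_distrib times_divide_eq_right)
  then have "(1 / 2) ^ k * (2 ^ k * (a ^ k / sqrt (fact k))) \<le> (1 / 2) ^ k * sqrt (exp ((2 * a)\<^sup>2))"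
    by (intro mult_left_mono) auto
  then show "norm (a ^ k / sqrt (fact k)) \<le> sqrt (exp ((2 * a)\<^sup>2)) * (1 / 2) ^ k"
    using assms by (simp add: power_one_over mult.commute)
qed simp

lemma sum_pois_mix_le_1:
  assumes Q: "Q \<in> prob_on t" and A: "finite A"
  shows "(\<Sum>k\<in>A. pois_mix Q k) \<le> 1"
  using sum_le_suminf[of "pois_mix Q" A] pois_mix_sums[OF Q] pois_mix_nonneg[OF Q] A
  by (auto simp: sums_iff)

lemma pois_mix_tail_le:
  assumes Q: "Q \<in> prob_on t" and t: "0 \<le> t"
  shows "1 - (\<Sum>k\<le>K. pois_mix Q k) \<le> (\<Sum>k. t ^ (k + Suc K) / fact (k + Suc K))"
proof -
  have s: "summable (pois_mix Q)" "suminf (pois_mix Q) = 1" using pois_mix_sums[OF Q] by (auto simp: sums_iff)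
  have s2: "summable (\<lambda>k. t ^ k / fact k)"
    using exp_converges[of t] by (simp add: divide_inverse mult.commute sums_iff)
  have "suminf (pois_mix Q) = (\<Sum>k. pois_mix Q (k + Suc K)) + (\<Sum>k<Suc K. pois_mix Q k)"
    by (rule suminf_split_initial_segment[OF s(1)])
  then have "1 - (\<Sum>k\<le>K. pois_mix Q k) = (\<Sum>k. pois_mix Q (k + Suc K))"
    unfolding s(2) lessThan_Suc_atMost by simp
  also have "\<dots> \<le> (\<Sum>k. t ^ (k + Suc K) / fact (k + Suc K))"
    by (rule suminf_le[OF pois_mix_le[OF Q] summable_ignore_initial_segment[OF s(1)] summable_ignore_initial_segment[OF s2]])
  finally show ?thesis .
qed

text \<open>The bound for every n and every cut \<open>K\<close>. Its summands stand for the indices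
  up to \<open>K\<close> on good samples, the indices beyond \<open>K\<close>, and the bad samples,
  on which the whole series is bounded trivially.\<close>

lemma expected_W1_smooth_npmle_le:
  fixes t \<sigma> :: real
  assumes t: "0 < t" and \<sigma>: "0 < \<sigma>"
  defines "\<rho> \<equiv> 4 * t / \<sigma>\<^sup>2" and "e \<equiv> \<lambda>k. (2 * t / \<sigma>) ^ k / sqrt (fact k)"
    and "\<tau> \<equiv> \<lambda>K. \<Sum>k. t ^ (k + Suc K) / fact (k + Suc K)"
  obtains C where "0 < C"
    "\<And>n K est Q. 0 < n \<Longrightarrow> is_npmle t n est \<Longrightarrow> Q \<in> prob_on t \<Longrightarrow>
      (\<integral>\<^sup>+ X. W1_smooth \<sigma> Q (est X) \<partial>(sample_law Q n)) \<le> ennreal (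
        C * sqrt (\<Sum>k\<le>K. \<rho> ^ k) * (sqrt (real n) * (4 * (real K + 1) / real n + 2 * \<tau> K) + 1 / sqrt (real n))
        + C * (\<Sum>k. e (k + Suc K)) + C * (\<Sum>k. e k) * (real n * \<tau> K))"
proof -
  obtain C where C: "0 < C" and W: "\<And>t Q R. Q \<in> prob_on t \<Longrightarrow> R \<in> prob_on t \<Longrightarrow>
     W1_smooth \<sigma> Q R \<le> (\<Sum>k. ennreal (C * ((2 / \<sigma>) ^ k * sqrt (fact k)) * \<bar>pois_mix Q k - pois_mix R k\<bar>))"
    by (rule W1_smooth_le_series[OF \<sigma>]) blast
  define b where "b k = C * ((2 / \<sigma>) ^ k * sqrt (fact k))" for k
  have b0: "0 \<le> b k" for k unfolding b_def using C \<sigma> by (intro mult_nonneg_nonneg) auto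
  have e0: "0 \<le> e k" for k unfolding e_def using t \<sigma> by (intro divide_nonneg_nonneg zero_le_power) auto
  have se: "summable e" unfolding e_def by (rule summable_power_div_sqrt_fact) (use t \<sigma> in simp)
  \<comment> \<open>The weight times the largest possible mass t^k / k!: a summable bound for the
    terms, uniform in both mixtures.\<close>
  have be: "b k * (t ^ k / fact k) = C * e k" for k
  proof -
    have "sqrt (fact k) / fact k = 1 / (sqrt (fact k) :: real)"
      by (simp add: divide_eq_eq eq_divide_eq)
    then have "b k * (t ^ k / fact k) = C * ((2 / \<sigma>) ^ k * t ^ k * (1 / sqrt (fact k)))"
      unfolding b_def by (metis (no_types, opaque_lifting) mult.assoc mult.commute times_divide_eq_right)
    then show ?thesis unfolding e_def by (simp only: power_mult_distrib[symmetric] times_divide_eq_left times_divide_eq_right mult_1_right)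
  qed
  \<comment> \<open>The factorial in the squared weight cancels against t^k / k!, leaving the
    geometric majorant for the Cauchy-Schwarz step.\<close>
  have b2: "(b k)\<^sup>2 * (t ^ k / fact k) = C\<^sup>2 * \<rho> ^ k" for k
  proof -
    have "(b k)\<^sup>2 = C\<^sup>2 * (((2 / \<sigma>) ^ k)\<^sup>2 * fact k)"
      unfolding b_def by (simp only: power_mult_distrib) simp
    also have "((2 / \<sigma>) ^ k)\<^sup>2 = ((2 / \<sigma>)\<^sup>2) ^ k" by (simp only: power_mult[symmetric] mult.commute)
    finally have "(b k)\<^sup>2 * (t ^ k / fact k) = C\<^sup>2 * (((2 / \<sigma>)\<^sup>2) ^ k * t ^ k)" by simp
    also have "((2 / \<sigma>)\<^sup>2) ^ k * t ^ k = \<rho> ^ k"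
      unfolding \<rho>_def power_mult_distrib[symmetric] by (simp add: power_divide)
    finally show ?thesis .
  qed
  have main: "(\<integral>\<^sup>+ X. W1_smooth \<sigma> Q (est X) \<partial>(sample_law Q n)) \<le> ennreal (
        C * sqrt (\<Sum>k\<le>K. \<rho> ^ k) * (sqrt (real n) * (4 * (real K + 1) / real n + 2 * \<tau> K) + 1 / sqrt (real n))
        + C * (\<Sum>k. e (k + Suc K)) + C * (\<Sum>k. e k) * (real n * \<tau> K))"
    if n: "0 < n" and est: "is_npmle t n est" and Q: "Q \<in> prob_on t" for n K est Q
  proof -
    let ?h = "pois_mix Q" and ?A = "{..K}"
    define M where "M = C * sqrt (\<Sum>k\<le>K. \<rho> ^ k)"
    define T where "T = C * (\<Sum>k. e k)"
    define T' where "T' = C * (\<Sum>k. e (k + Suc K))"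
    define miss where "miss = 1 - (\<Sum>k\<le>K. ?h k)"
    define G where "G X = M * (sqrt (real n) * (4 * chi2_stat ?A ?h n X + 2 * miss) + 1 / sqrt (real n)) + T' + T * misses ?A ?h n X" for X
    have \<rho>0: "0 \<le> \<rho>" using t by (simp add: \<rho>_def)
    have M0: "0 \<le> M" unfolding M_def using C \<rho>0 by (auto intro!: mult_nonneg_nonneg sum_nonneg)
    have T0: "0 \<le> T" unfolding T_def using C e0 se by (auto intro!: mult_nonneg_nonneg suminf_nonneg)
    have T'0: "0 \<le> T'" unfolding T'_def using C e0
      by (intro mult_nonneg_nonneg suminf_nonneg[OF summable_ignore_initial_segment[OF se]]) auto
    have miss0: "0 \<le> miss"
      unfolding miss_def using sum_pois_mix_le_1[OF Q, of ?A] by simp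
    have chi0: "0 \<le> chi2_stat ?A ?h n X" for X
      unfolding chi2_stat_def using pois_mix_nonneg[OF Q] by (intro sum_nonneg divide_nonneg_nonneg) auto
    have mis0: "0 \<le> misses ?A ?h n X" for X unfolding misses_def by (intro sum_nonneg) auto
    have G0: "0 \<le> G X" for X unfolding G_def using M0 T0 T'0 miss0 chi0[of X] mis0[of X]
      by (intro add_nonneg_nonneg mult_nonneg_nonneg) auto
    have pointwise: "W1_smooth \<sigma> Q (est X) \<le> ennreal (G X)" for X
    proof -
      have R: "est X \<in> prob_on t" and like: "(\<Prod>i<n. ?h (X i)) \<le> (\<Prod>i<n. pois_mix (est X) (X i))"
        using est Q unfolding is_npmle_def by auto
      let ?h' = "pois_mix (est X)"
      let ?f = "\<lambda>k. b k * \<bar>?h k - ?h' k\<bar>"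
      have f0: "0 \<le> ?f k" for k using b0 by simp
      have fe: "?f k \<le> C * e k" for k
      proof -
        have "\<bar>?h k - ?h' k\<bar> \<le> t ^ k / fact k"
          using pois_mix_le[OF Q, of k] pois_mix_le[OF R, of k] pois_mix_nonneg[OF Q, of k] pois_mix_nonneg[OF R, of k]
          by (simp add: abs_le_iff)
        from mult_left_mono[OF this b0[of k]] show ?thesis unfolding be .
      qed
      have sCe: "summable (\<lambda>k. C * e k)" by (rule summable_mult[OF se])
      have sf: "summable ?f" by (rule summable_comparison_test[OF _ sCe]) (use f0 fe in auto)
      have "W1_smooth \<sigma> Q (est X) \<le> (\<Sum>k. ennreal (?f k))" unfolding b_def by (rule W[OF Q R])
      also have "\<dots> = ennreal (suminf ?f)" by (rule suminf_ennreal2[OF f0 sf])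
      also have "\<dots> \<le> ennreal (G X)"
      \<comment> \<open>The likelihood comparison needs every sample point in {0..K} with positive
        mass. Otherwise \<open>misses\<close> is at least 1 and \<open>T\<close> alone bounds the
        series.\<close>
      proof (rule ennreal_leI, cases "\<forall>i<n. X i \<in> ?A \<and> 0 < ?h (X i)")
        case False
        then obtain i where i: "i < n" "\<not> (X i \<in> ?A \<and> 0 < ?h (X i))" by blast
        have "(if X i \<in> ?A \<and> 0 < ?h (X i) then 0 else 1) \<le> misses ?A ?h n X"
          unfolding misses_def by (rule member_le_sum) (use i in auto)
        then have "1 \<le> misses ?A ?h n X" unfolding if_not_P[OF i(2)] .
        have "suminf ?f \<le> T" unfolding T_def suminf_mult[OF se, symmetric] by (rule suminf_le[OF fe sf sCe])
        also have "\<dots> \<le> T * misses ?A ?h n X" using T0 \<open>1 \<le> misses ?A ?h n X\<close> mult_left_mono by fastforce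
        also have "\<dots> \<le> G X" unfolding G_def using M0 T'0 miss0 chi0[of X]
          by (simp add: add_nonneg_nonneg mult_nonneg_nonneg)
        finally show "suminf ?f \<le> G X" .
      next
        case True
        let ?D = "\<Sum>k\<le>K. (sqrt (?h k) - sqrt (?h' k))\<^sup>2"
        have sub: "(\<Sum>k\<le>K. ?h' k) \<le> 1"
          by (rule sum_pois_mix_le_1[OF R]) simp
        have D: "?D \<le> 4 * chi2_stat ?A ?h n X + 2 * miss"
          unfolding miss_def
          by (rule hellinger_mle_le_chi2) (use True n like sub pois_mix_nonneg[OF Q] pois_mix_nonneg[OF R] in auto)
        \<comment> \<open>The parameter l = sqrt n balances l D against 1/l up to the factor K + 1,
          as D has mean of order (K + 1)/n.\<close>
        have "(\<Sum>k\<le>K. ?f k) \<le> sqrt (\<Sum>k\<le>K. C\<^sup>2 * \<rho> ^ k) * (sqrt (real n) * ?D + 1 / sqrt (real n))"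
        proof (rule weighted_l1_le_hellinger)
          show "(b k)\<^sup>2 * ?h k \<le> C\<^sup>2 * \<rho> ^ k" "(b k)\<^sup>2 * ?h' k \<le> C\<^sup>2 * \<rho> ^ k" for k
            unfolding b2[symmetric] by (intro mult_left_mono pois_mix_le[OF Q] pois_mix_le[OF R] zero_le_power2)+
        qed (use n b0 pois_mix_nonneg[OF Q] pois_mix_nonneg[OF R] in auto)
        also have "sqrt (\<Sum>k\<le>K. C\<^sup>2 * \<rho> ^ k) = M"
          using C by (simp add: M_def sum_distrib_left[symmetric] real_sqrt_mult)
        also have "M * (sqrt (real n) * ?D + 1 / sqrt (real n))
            \<le> M * (sqrt (real n) * (4 * chi2_stat ?A ?h n X + 2 * miss) + 1 / sqrt (real n))"
          using M0 D by (intro mult_left_mono add_right_mono) auto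
        finally have head: "(\<Sum>k\<le>K. ?f k) \<le> M * (sqrt (real n) * (4 * chi2_stat ?A ?h n X + 2 * miss) + 1 / sqrt (real n))" .
        have tail: "(\<Sum>k. ?f (k + Suc K)) \<le> T'"
          unfolding T'_def suminf_mult[OF summable_ignore_initial_segment[OF se], symmetric]
          by (rule suminf_le[OF fe summable_ignore_initial_segment[OF sf] summable_ignore_initial_segment[OF sCe]])
        have "suminf ?f = (\<Sum>k. ?f (k + Suc K)) + (\<Sum>k<Suc K. ?f k)"
          by (rule suminf_split_initial_segment[OF sf])
        then have "suminf ?f \<le> T' + M * (sqrt (real n) * (4 * chi2_stat ?A ?h n X + 2 * miss) + 1 / sqrt (real n))"
          unfolding lessThan_Suc_atMost using head tail by simp
        also have "\<dots> \<le> G X" unfolding G_def using T0 mis0[of X] by simp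
        finally show "suminf ?f \<le> G X" .
      qed
      finally show ?thesis .
    qed
    interpret S: prob_space "sample_law Q n"
      unfolding sample_law_def by (intro prob_space_PiM prob_space_pois_mix_measure[OF Q])
    have chi: "integrable (sample_law Q n) (chi2_stat ?A ?h n)"
      "(\<integral>X. chi2_stat ?A ?h n X \<partial>sample_law Q n) \<le> (real K + 1) / real n"
      using expectation_chi2_stat[OF Q n, of ?A] by (auto simp: add.commute)
    have mis: "integrable (sample_law Q n) (misses ?A ?h n)"
      "(\<integral>X. misses ?A ?h n X \<partial>sample_law Q n) = real n * miss"
      using expectation_misses[OF Q, of ?A n] by (auto simp: miss_def)
    have intG: "integrable (sample_law Q n) G"
      unfolding G_def using chi(1) mis(1) by simp
    have miss: "miss \<le> \<tau> K" unfolding miss_def \<tau>_def using pois_mix_tail_le[OF Q] t by simp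
    \<comment> \<open>The left integrand may fail to be measurable; monotonicity of the integral
      applies all the same, and \<open>G\<close> is integrable.\<close>
    have "(\<integral>\<^sup>+ X. W1_smooth \<sigma> Q (est X) \<partial>(sample_law Q n)) \<le> (\<integral>\<^sup>+ X. ennreal (G X) \<partial>(sample_law Q n))"
      by (intro nn_integral_mono pointwise)
    also have "\<dots> = ennreal (\<integral>X. G X \<partial>sample_law Q n)"
      by (rule nn_integral_eq_integral[OF intG]) (use G0 in auto)
    also have "(\<integral>X. G X \<partial>sample_law Q n)
        = M * (sqrt (real n) * (4 * (\<integral>X. chi2_stat ?A ?h n X \<partial>sample_law Q n) + 2 * miss) + 1 / sqrt (real n)) + T' + T * (real n * miss)"
      unfolding G_def mis(2)[symmetric] using chi(1) mis(1) by (simp add: S.prob_space)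
    also have "\<dots> \<le> M * (sqrt (real n) * (4 * ((real K + 1) / real n) + 2 * \<tau> K) + 1 / sqrt (real n)) + T' + T * (real n * \<tau> K)"
      using chi(2) miss M0 T0
      by (intro add_mono mult_left_mono order_refl) auto
    finally show ?thesis by (simp only: M_def T_def T'_def times_divide_eq_right ennreal_leI)
  qed
  show ?thesis by (rule that[OF C main])
qed

section \<open>The cut K = 16 ln n / ln ln n and the resulting rate\<close>

text \<open>Stirling in the weak form \<open>k! \<ge> (k / e)\<^sup>k\<close> is enough, because \<open>K ln K\<close> is of order \<open>16 ln n\<close>.\<close>
lemma eventually_tail_le:
  fixes A :: real
  assumes A: "0 < A"
  shows "\<forall>\<^sub>F n in sequentially. \<forall>K. 16 * ln (real n) / ln (ln (real n)) \<le> real K + 1 \<longrightarrow>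
    (\<Sum>k. A ^ (k + Suc K) / sqrt (fact (k + Suc K))) \<le> 1 / (real n)\<^sup>2"
proof -
  define c where "c = ln (2 * A)"
  \<comment> \<open>With k >= 16 L / LL, where L = ln n and LL = ln L, multiplying by k makes the
    left side at least 2 L, the exponent of n^(-2). It holds eventually because the logarithm on the
    right is asymptotic to LL.\<close>
  have ev: "\<forall>\<^sub>F n in sequentially. ln (ln (real n)) / 8 \<le> ln (16 * ln (real n) / ln (ln (real n))) / 2 - 1 / 2 - c"
    by real_asymp
  have ev2: "\<forall>\<^sub>F n in sequentially. 1 \<le> ln (ln (real n))" by real_asymp
  have ev3: "\<forall>\<^sub>F n in sequentially. 1 \<le> ln (real n)" by real_asymp
  show ?thesis
    using ev ev2 ev3 eventually_gt_at_top[of 0]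
  proof eventually_elim
    case (elim n)
    define L where "L = ln (real n)"
    define LL where "LL = ln L"
    have L: "1 \<le> L" and LL: "1 \<le> LL" and ineq: "LL / 8 \<le> ln (16 * L / LL) / 2 - 1 / 2 - c"
      using elim by (auto simp: L_def LL_def)
    \<comment> \<open>The base is 2 A instead of A so that a factor 2^(-k) is left over for summing
      the tail.\<close>
    have term_le: "(2 * A) ^ k / sqrt (fact k) \<le> 1 / (real n)\<^sup>2" if k: "16 * L / LL \<le> real k" for k :: nat
    proof -
      have k0: "0 < real k" using k L LL by (smt (verit) divide_pos_pos)
      have "real k ^ k / fact k \<le> exp (real k)" by (rule power_div_fact_le_exp) simp
      then have "real k ^ k / exp (real k) \<le> fact k" by (simp add: field_simps)
      then have "ln (real k ^ k / exp (real k)) \<le> ln (fact k)" using k0 by simp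
      then have f: "real k * ln (real k) - real k \<le> ln (fact k)" using k0 by (simp add: ln_div ln_realpow)
      have "ln (16 * L / LL) \<le> ln (real k)" using k L LL k0 by (subst ln_le_cancel_iff) auto
      with ineq have "LL / 8 \<le> ln (real k) / 2 - 1 / 2 - c" by linarith
      then have "real k * (LL / 8) \<le> real k * (ln (real k) / 2 - 1 / 2 - c)" by (rule mult_left_mono) simp
      moreover have "2 * L \<le> real k * (LL / 8)" using k LL by (simp add: field_simps)
      ultimately have up: "2 * L \<le> ln (fact k) / 2 - real k * c" using f by (simp add: algebra_simps)
      have "ln ((2 * A) ^ k / sqrt (fact k)) \<le> - (2 * L)"
      proof -
        have "ln ((2 * A) ^ k) = real k * c" unfolding c_def by (rule ln_realpow)
        moreover have "ln (sqrt (fact k)) = ln (fact k) / (2 :: real)" by (rule ln_sqrt) simp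
        ultimately show ?thesis using A up by (subst ln_div) auto
      qed
      then have "exp (ln ((2 * A) ^ k / sqrt (fact k))) \<le> exp (- (2 * L))" by (simp only: exp_le_cancel_iff)
      then have "(2 * A) ^ k / sqrt (fact k) \<le> exp (- (2 * L))"
        using A by (subst (asm) exp_ln) auto
      also have "exp (- (2 * L)) = 1 / (real n)\<^sup>2"
      proof -
        have "exp L = real n" using elim(4) by (simp add: L_def)
        then show ?thesis by (simp only: exp_minus mult_2 exp_add power2_eq_square inverse_eq_divide)
      qed
      finally show ?thesis .
    qed
    show ?case
    proof (intro allI impI)
      fix K assume K: "16 * ln (real n) / ln (ln (real n)) \<le> real K + 1"
      have s: "summable (\<lambda>k. A ^ k / sqrt (fact k))" by (rule summable_power_div_sqrt_fact) (use A in simp)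
      have g: "(\<lambda>k. 1 / (real n)\<^sup>2 * (1 / 2) ^ Suc k) sums (1 / (real n)\<^sup>2 * 1)"
        by (intro sums_mult power_half_series)
      have "(\<Sum>k. A ^ (k + Suc K) / sqrt (fact (k + Suc K))) \<le> (\<Sum>k. 1 / (real n)\<^sup>2 * (1 / 2) ^ Suc k)"
      proof (rule suminf_le[OF _ summable_ignore_initial_segment[OF s] sums_summable[OF g]])
        fix k
        define j where "j = k + Suc K"
        \<comment> \<open>Tail indices start at K + 1, so rounding the cut down is harmless.\<close>
        have "16 * L / LL \<le> real j" using K unfolding j_def L_def LL_def by simp
        from term_le[OF this] have "2 ^ j * (A ^ j / sqrt (fact j)) \<le> 1 / (real n)\<^sup>2"
          by (simp only: power_mult_distrib times_divide_eq_right)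
        then have "(1 / 2) ^ j * (2 ^ j * (A ^ j / sqrt (fact j))) \<le> (1 / 2) ^ j * (1 / (real n)\<^sup>2)"
          by (rule mult_left_mono) simp
        then have "A ^ j / sqrt (fact j) \<le> (1 / 2) ^ j * (1 / (real n)\<^sup>2)"
          by (simp add: power_one_over)
        also have "\<dots> \<le> (1 / 2) ^ Suc k * (1 / (real n)\<^sup>2)"
          by (intro mult_right_mono power_decreasing) (auto simp: j_def)
        finally show "A ^ (k + Suc K) / sqrt (fact (k + Suc K)) \<le> 1 / (real n)\<^sup>2 * (1 / 2) ^ Suc k"
          by (simp only: j_def mult.commute)
      qed
      also have "\<dots> = 1 / (real n)\<^sup>2" using g by (simp add: sums_iff)
      finally show "(\<Sum>k. A ^ (k + Suc K) / sqrt (fact (k + Suc K))) \<le> 1 / (real n)\<^sup>2" .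
    qed
  qed
qed

text \<open>Each term is bounded by its largest possible value, which treats \<open>\<rho>\<close> =
  1 together with the other cases. The resulting factor K + 1 is logarithmic, and the root halves 16
  to 8.\<close>

lemma sqrt_geometric_sum_le:
  fixes \<rho> :: real
  assumes "0 < \<rho>" and K: "real K \<le> 16 * l"
  shows "sqrt (\<Sum>k\<le>K. \<rho> ^ k) \<le> (real K + 1) * (if 1 < \<rho> then exp (8 * l * ln \<rho>) else 1)"
proof -
  define r where "r = (if 1 < \<rho> then exp (8 * l * ln \<rho>) else 1)"
  have r1: "0 \<le> r" by (simp add: r_def)
  have pw: "\<rho> ^ k \<le> r\<^sup>2" if "k \<le> K" for k
  proof (cases "1 < \<rho>")
    case True
    have "\<rho> ^ k = exp (real k * ln \<rho>)" using assms(1) by (simp add: exp_of_nat_mult)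
    also have "\<dots> \<le> exp (16 * l * ln \<rho>)" using True that K by (auto intro!: mult_right_mono)
    also have "\<dots> = r\<^sup>2" using True by (simp add: r_def power2_eq_square exp_add[symmetric])
    finally show ?thesis .
  next
    case False
    then show ?thesis using assms(1) by (simp add: r_def power_le_one)
  qed
  have "sqrt (\<Sum>k\<le>K. \<rho> ^ k) \<le> sqrt (\<Sum>k\<le>K. r\<^sup>2)"
    by (intro real_sqrt_le_mono sum_mono) (use pw in auto)
  also have "\<dots> = sqrt (real K + 1) * r" using r1 by (simp add: real_sqrt_mult add.commute)
  also have "\<dots> \<le> (real K + 1) * r"
  proof (rule mult_right_mono[OF _ r1])
    show "sqrt (real K + 1) \<le> real K + 1"
      by (rule real_le_lsqrt) (simp_all add: power2_eq_square algebra_simps)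
  qed
  finally show ?thesis by (simp add: r_def)
qed

theorem theorem1:
  fixes tstar \<sigma> :: real
  assumes "tstar > 0" and "\<sigma> > 0"
  defines "c \<equiv> 8 * ln (4 * tstar / \<sigma>\<^sup>2)"
  shows "\<exists>a>0. \<exists>C. \<exists>N. \<forall>n\<ge>N. \<forall>est. is_npmle tstar n est \<longrightarrow>
     (\<forall>Q\<in>prob_on tstar.
        (\<integral>\<^sup>+ X. W1_smooth \<sigma> Q (est X) \<partial>(sample_law Q n))
          \<le> ennreal (C * (if \<sigma>\<^sup>2 < 4 * tstar
                           then real n powr (- 1/2 + c / ln (ln (real n))) * ln (real n) powr a
                           else real n powr (- 1/2) * ln (real n) powr a)))"
proof -
  define \<rho> where "\<rho> = 4 * tstar / \<sigma>\<^sup>2"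
  define e :: "nat \<Rightarrow> real" where "e = (\<lambda>k. (2 * tstar / \<sigma>) ^ k / sqrt (fact k))"
  define \<tau> where "\<tau> = (\<lambda>K. \<Sum>k. tstar ^ (k + Suc K) / fact (k + Suc K))"
  obtain C where C: "0 < C" and bound: "\<And>n K est Q. 0 < n \<Longrightarrow> is_npmle tstar n est \<Longrightarrow> Q \<in> prob_on tstar \<Longrightarrow>
      (\<integral>\<^sup>+ X. W1_smooth \<sigma> Q (est X) \<partial>(sample_law Q n)) \<le> ennreal (
        C * sqrt (\<Sum>k\<le>K. \<rho> ^ k) * (sqrt (real n) * (4 * (real K + 1) / real n + 2 * \<tau> K) + 1 / sqrt (real n))
        + C * (\<Sum>k. e (k + Suc K)) + C * (\<Sum>k. e k) * (real n * \<tau> K))"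
    by (rule expected_W1_smooth_npmle_le[OF assms(1,2)], rule that, assumption, unfold \<rho>_def e_def \<tau>_def)
  define T where "T = (\<Sum>k. e k)"
  \<comment> \<open>The power 2 collects one logarithm from the root of the geometric sum and one
    from the mean K + 1 of n times the chi-square statistic.\<close>
  define rate where "rate n = (if \<sigma>\<^sup>2 < 4 * tstar
      then real n powr (- 1/2 + c / ln (ln (real n))) * ln (real n) powr 2
      else real n powr (- 1/2) * ln (real n) powr 2)" for n
  have \<rho>0: "0 < \<rho>" and \<rho>1: "1 < \<rho> \<longleftrightarrow> \<sigma>\<^sup>2 < 4 * tstar" using assms(1,2) by (auto simp: \<rho>_def field_simps)
  have c: "c = 8 * ln \<rho>" by (simp add: c_def \<rho>_def)
  have st: "summable (\<lambda>k. tstar ^ k / sqrt (fact k))" by (rule summable_power_div_sqrt_fact) (use assms(1) in simp)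
  have st': "summable (\<lambda>k. tstar ^ k / fact k)"
    using exp_converges[of tstar] by (simp add: divide_inverse mult.commute sums_iff)
  \<comment> \<open>Replacing k! by its root lets one tail estimate serve both \<open>\<tau>\<close>
    and the tail of \<open>e\<close>.\<close>
  have \<tau>_le: "\<tau> K \<le> (\<Sum>k. tstar ^ (k + Suc K) / sqrt (fact (k + Suc K)))" for K
    unfolding \<tau>_def
  proof (rule suminf_le[OF _ summable_ignore_initial_segment[OF st'] summable_ignore_initial_segment[OF st]])
    fix k
    have "sqrt (fact (k + Suc K)) \<le> (fact (k + Suc K) :: real)"
      by (rule real_le_lsqrt) (auto simp: power2_eq_square fact_ge_1 simp del: fact_Suc)
    then show "tstar ^ (k + Suc K) / fact (k + Suc K) \<le> tstar ^ (k + Suc K) / sqrt (fact (k + Suc K))"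
      using assms(1) by (intro divide_left_mono) (auto simp del: fact_Suc)
  qed
  have se: "summable e" unfolding e_def by (rule summable_power_div_sqrt_fact) (use assms in simp)
  have T0: "0 \<le> T" unfolding T_def by (rule suminf_nonneg[OF se]) (use assms in \<open>simp add: e_def\<close>)
  have \<tau>0: "0 \<le> \<tau> K" for K unfolding \<tau>_def
    by (rule suminf_nonneg[OF summable_ignore_initial_segment[OF st']]) (use assms in simp)
  have t2: "0 < 2 * tstar / \<sigma>" using assms by simp
  have ev2: "\<forall>\<^sub>F n in sequentially. 1 \<le> ln (ln (real n))" by real_asymp
  have ev3: "\<forall>\<^sub>F n in sequentially. 1 \<le> ln (real n)" by real_asymp
  \<comment> \<open>The head gives 17 * 71 = 1207, the tail of \<open>e\<close> gives 1 and the bad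
    samples give \<open>T\<close>; 1300 is a rounding up.\<close>
  have "\<forall>\<^sub>F n in sequentially. \<forall>est. is_npmle tstar n est \<longrightarrow> (\<forall>Q\<in>prob_on tstar.
     (\<integral>\<^sup>+ X. W1_smooth \<sigma> Q (est X) \<partial>(sample_law Q n)) \<le> ennreal (C * (1300 + T) * rate n))"
    using eventually_tail_le[OF assms(1)] eventually_tail_le[OF t2] ev2 ev3 eventually_gt_at_top[of 0]
  proof eventually_elim
    case (elim n)
    define L where "L = ln (real n)"
    define LL where "LL = ln L"
    \<comment> \<open>The floor gives K <= 16 L / LL, which controls the growth of
      \<open>\<rho>\<close> ^ K, and 16 L / LL <= K + 1, which controls the tails.\<close>
    define K where "K = nat \<lfloor>16 * L / LL\<rfloor>"
    define r where "r = (if 1 < \<rho> then exp (8 * (L / LL) * ln \<rho>) else 1)"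
    define s where "s = 1 / sqrt (real n)"
    have L: "1 \<le> L" and LL: "1 \<le> LL" and n: "1 \<le> real n" using elim by (auto simp: L_def LL_def)
    have q0: "0 \<le> 16 * L / LL" using L LL by simp
    have Kle: "real K \<le> 16 * (L / LL)" unfolding K_def using q0 by simp
    have Kge: "16 * ln (real n) / ln (ln (real n)) \<le> real K + 1"
      unfolding K_def using q0 by (simp add: L_def[symmetric] LL_def[symmetric])
    have "L / LL \<le> L" using L LL by (simp add: field_simps)
    with Kle L have K17: "real K + 1 \<le> 17 * L" by linarith
    have r1: "1 \<le> r" unfolding r_def using L LL by (auto intro!: mult_nonneg_nonneg)
    have s0: "0 < s" and s1: "s \<le> 1" using n by (auto simp: s_def)
    have ss: "s * s = 1 / real n" using n by (simp add: s_def)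
    have tau: "\<tau> K \<le> 1 / (real n)\<^sup>2" using \<tau>_le[of K] elim(1) Kge order_trans by blast
    have tail: "(\<Sum>k. e (k + Suc K)) \<le> 1 / (real n)\<^sup>2" using elim(2) Kge unfolding e_def by blast
    have n2: "1 / (real n)\<^sup>2 = s * s * (s * s)" unfolding ss by (simp add: power2_eq_square)
    have sq: "sqrt (real n) * s = 1" using n by (simp add: s_def)
    have "s * s * s \<le> 1 * 1 * 1" using s0 s1 by (intro mult_mono) auto
    then have s4: "s * s * (s * s) \<le> s" using s0 mult_right_mono[of "s * s * s" 1 s] by (simp add: mult.assoc)
    have rate: "rate n = r * L\<^sup>2 * s"
    proof -
      have p: "real n powr (- 1 / 2) = s" using n
        by (simp add: s_def powr_minus_divide powr_half_sqrt)
      \<comment> \<open>Here n^(c / ln ln n) = exp (L * 8 ln \<open>\<rho>\<close> / LL), which is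
        exactly \<open>r\<close> when \<open>\<rho>\<close> > 1.\<close>
      have "real n powr (- 1/2 + c / ln (ln (real n))) = s * exp (8 * (L / LL) * ln \<rho>)"
        unfolding powr_add p using n by (simp add: powr_def c L_def LL_def mult_ac)
      then show ?thesis using L n p by (auto simp: rate_def \<rho>1[symmetric] r_def L_def powr_numeral)
    qed
    have LrL: "1 \<le> r * L\<^sup>2" using r1 L mult_mono[of 1 r 1 "L\<^sup>2"] by (simp add: one_le_power)
    have M: "sqrt (\<Sum>k\<le>K. \<rho> ^ k) \<le> 17 * L * r"
    proof -
      have "sqrt (\<Sum>k\<le>K. \<rho> ^ k) \<le> (real K + 1) * r" unfolding r_def by (rule sqrt_geometric_sum_le[OF \<rho>0 Kle])
      also have "\<dots> \<le> 17 * L * r" using K17 r1 by (intro mult_right_mono) auto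
      finally show ?thesis .
    qed
    have br: "sqrt (real n) * (4 * (real K + 1) / real n + 2 * \<tau> K) + 1 / sqrt (real n) \<le> 71 * L * s"
    proof -
      have "sqrt (real n) * (4 * (real K + 1) / real n + 2 * \<tau> K) \<le> sqrt (real n) * (4 * (17 * L) * (s * s) + 2 * (s * s * (s * s)))"
      proof (intro mult_left_mono add_mono)
        show "4 * (real K + 1) / real n \<le> 4 * (17 * L) * (s * s)"
          unfolding ss using K17 n by (simp add: divide_right_mono)
        show "\<tau> K \<le> s * s * (s * s)" using tau n2 by simp
      qed auto
      also have "\<dots> = (sqrt (real n) * s) * (68 * L * s + 2 * (s * s * s))" by (simp add: algebra_simps)
      also have "\<dots> \<le> 68 * L * s + 2 * s" unfolding sq using s0 s1 by (simp add: mult_le_one)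
      finally have "sqrt (real n) * (4 * (real K + 1) / real n + 2 * \<tau> K) + 1 / sqrt (real n) \<le> 68 * L * s + 3 * s"
        by (simp add: s_def)
      also have "\<dots> \<le> 71 * L * s" using L s0 by simp
      finally show ?thesis .
    qed
    have "C * sqrt (\<Sum>k\<le>K. \<rho> ^ k) * (sqrt (real n) * (4 * (real K + 1) / real n + 2 * \<tau> K) + 1 / sqrt (real n))
        \<le> C * (17 * L * r) * (71 * L * s)"
      using C M br L r1 \<tau>0[of K] n by (intro mult_mono mult_left_mono add_nonneg_nonneg mult_nonneg_nonneg) auto
    also have "\<dots> = C * 1207 * (r * L\<^sup>2 * s)" by (simp add: power2_eq_square)
    finally have b1: "C * sqrt (\<Sum>k\<le>K. \<rho> ^ k) * (sqrt (real n) * (4 * (real K + 1) / real n + 2 * \<tau> K) + 1 / sqrt (real n))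
        \<le> C * 1207 * (r * L\<^sup>2 * s)" .
    have srl: "s \<le> r * L\<^sup>2 * s" using LrL s0 by simp
    have b2: "C * (\<Sum>k. e (k + Suc K)) \<le> C * (r * L\<^sup>2 * s)"
      using C tail n2 s4 srl by (intro mult_left_mono) auto
    \<comment> \<open>The union bound multiplies the tail by n; this is where decay n^(-2), and not
      merely n^(-1), is used.\<close>
    have "real n * \<tau> K \<le> real n * (1 / (real n)\<^sup>2)" using tau by (intro mult_left_mono) auto
    also have "\<dots> = s * s" unfolding ss using n by (simp add: power2_eq_square)
    also have "\<dots> \<le> s" using s0 s1 by simp
    finally have "real n * \<tau> K \<le> r * L\<^sup>2 * s" using srl by linarith
    then have b3: "C * (\<Sum>k. e k) * (real n * \<tau> K) \<le> C * T * (r * L\<^sup>2 * s)"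
      unfolding T_def[symmetric] using C T0 by (intro mult_left_mono) auto
    have rn: "0 \<le> C * (r * L\<^sup>2 * s)" using C r1 s0 by simp
    have tot: "C * sqrt (\<Sum>k\<le>K. \<rho> ^ k) * (sqrt (real n) * (4 * (real K + 1) / real n + 2 * \<tau> K) + 1 / sqrt (real n))
        + C * (\<Sum>k. e (k + Suc K)) + C * (\<Sum>k. e k) * (real n * \<tau> K) \<le> C * (1300 + T) * rate n"
    proof -
      have "C * (1300 + T) * rate n = C * 1207 * (r * L\<^sup>2 * s) + 93 * (C * (r * L\<^sup>2 * s)) + C * T * (r * L\<^sup>2 * s)"
        unfolding rate by (simp add: algebra_simps)
      with b1 b2 b3 rn show ?thesis by linarith
    qed
    show ?case
    proof (intro allI impI ballI)
      fix est Q assume "is_npmle tstar n est" "Q \<in> prob_on tstar"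
      from bound[OF elim(5) this, of K] ennreal_leI[OF tot]
      show "(\<integral>\<^sup>+ X. W1_smooth \<sigma> Q (est X) \<partial>(sample_law Q n)) \<le> ennreal (C * (1300 + T) * rate n)"
        by (rule order_trans)
    qed
  qed
  then obtain N where "\<forall>n\<ge>N. \<forall>est. is_npmle tstar n est \<longrightarrow> (\<forall>Q\<in>prob_on tstar.
     (\<integral>\<^sup>+ X. W1_smooth \<sigma> Q (est X) \<partial>(sample_law Q n)) \<le> ennreal (C * (1300 + T) * rate n))"
    unfolding eventually_sequentially by blast
  then show ?thesis
    unfolding rate_def by (intro exI[of _ 2] conjI exI[of _ "C * (1300 + T)"] exI[of _ N]) auto
qed

end
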